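(* Let $q$ be an odd prime power, and let $\mathcal{S}$ be a special set of $\mathsf{H}(3,q^2)$ such that the following hold: (i) There is a point $P\in\mathcal{S}$ and a totally isotropic line $\ell$ through $P$ such that for every Baer subline $b$ of $\ell$ containing $P$, the points of $\mathcal{S}$ that are collinear with a point of $b$ are coplanar. (ii) There is a point $Q\in\mathcal{S}$, $Q\neq P$, such that for every $R\neq P,Q$ in $\mathcal{S}$, the triangle $PQR$ is in perspective. Then $\mathcal{S}$ is equivalent under the collineation group of $\mathsf{H}(3,q^2)$ to the Hermitian Veronesean $\mathcal{V}$.
   Context: Points of $\mathrm{PG}(3,q^2)$ are given by homogeneous coordinates $(X_0,X_1,X_2,X_3)$ over $\mathbb{F}_{q^2}$. Let $h(X,Y)=X_0Y_3^q+X_3Y_0^q-X_1Y_1^q-X_2Y_2^q$, and let $\mathsf{H}(3,q^2)$ be the associated Hermitian surface, i.e. the set of points $X$ with $h(X,X)=0$. Two points $X,Y$ of $\mathsf{H}(3,q^2)$ are called collinear if $h(X,Y)=0$ (for distinct points: the line $XY$ is contained in $\mathsf{H}(3,q^2)$; each point is collinear with itself, so in (i) the point $P\in b\cap\mathcal{S}$ is among the points considered). A line is totally isotropic if it is contained in $\mathsf{H}(3,q^2)$. Let $\perp$ be the polarity of $\mathrm{PG}(3,q^2)$ defined by $h$. A plane is degenerate if the restriction of $h$ to it is degenerate, and nondegenerate otherwise. A special set of $\mathsf{H}(3,q^2)$, $q$ odd, is a set $\mathcal{S}$ of $q^2+1$ points of $\mathsf{H}(3,q^2)$ such that every point of $\mathsf{H}(3,q^2)$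 not in $\mathcal{S}$ is collinear with $0$ or $2$ points of $\mathcal{S}$; equivalently, a set of $q^2+1$ points of $\mathsf{H}(3,q^2)$ such that any three span a nondegenerate plane. A Baer subline of a line of $\mathrm{PG}(3,q^2)$ is a set of $q+1$ points of the form $\{\langle \lambda u+\mu v\rangle:(\lambda,\mu)\in\mathbb{F}_q^2\setminus\{(0,0)\}\}$, where $u,v$ are linearly independent vectors spanning the line. Three pairwise noncollinear points $A,B,C$ of $\mathsf{H}(3,q^2)$ are in perspective (the triangle $ABC$ is in perspective) if the planes $\langle A^\perp\cap B^\perp,C\rangle$, $\langle B^\perp\cap C^\perp,A\rangle$, $\langle C^\perp\cap A^\perp,B\rangle$ intersect in a line. The collineation group of $\mathsf{H}(3,q^2)$ is $\mathrm{P\Gamma U}(4,q)$, the group of all collineations of $\mathrm{PG}(3,q^2)$ (induced by semilinear maps) that stabilise $\mathsf{H}(3,q^2)$. The Hermitian Veronesean is $\mathcal{V}=\{(1,x,x^q,x^{q+1}):x\in\mathbb{F}_{q^2}\}\cup\{(0,0,0,1)\}$. *)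

theory Defs
  imports "HOL-Analysis.Analysis" "HOL-Number_Theory.Prime_Powers"
begin

text \<open>
  The field of order \<open>q\<^sup>2\<close> is a finite field type \<open>'a\<close> with \<open>CARD('a) = q\<^sup>2\<close>.
  Subspaces of \<open>PG(3, q\<^sup>2)\<close> are linear subspaces of \<open>'a ^ 4\<close>, and a set of points is a
  set of one-dimensional subspaces. The homogeneous coordinates \<open>X\<^sub>0, X\<^sub>1, X\<^sub>2, X\<^sub>3\<close> are the
  components \<open>X $ 1, X $ 2, X $ 3, X $ 4\<close>, in this order, which is the order used by
  \<^const>\<open>vector\<close>.
\<close>

lemma vector_4:
  fixes a b c d :: "'a::zero"
  shows "(vector [a, b, c, d] :: 'a ^ 4) $ 1 = a"
    and "(vector [a, b, c, d] :: 'a ^ 4) $ 2 = b"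
    and "(vector [a, b, c, d] :: 'a ^ 4) $ 3 = c"
    and "(vector [a, b, c, d] :: 'a ^ 4) $ 4 = d"
  unfolding vector_def by simp_all

type_synonym 'a subsp = "('a ^ 4) set"

definition pg_point :: "'a::field subsp \<Rightarrow> bool" where
  "pg_point U \<longleftrightarrow> vec.subspace U \<and> vec.dim U = 1"

definition pg_line :: "'a::field subsp \<Rightarrow> bool" where
  "pg_line U \<longleftrightarrow> vec.subspace U \<and> vec.dim U = 2"

definition pg_plane :: "'a::field subsp \<Rightarrow> bool" where
  "pg_plane U \<longleftrightarrow> vec.subspace U \<and> vec.dim U = 3"

definition coplanar_points :: "'a::field subsp set \<Rightarrow> bool" where
  "coplanar_points T \<longleftrightarrow> (\<exists>U. pg_plane U \<and> (\<forall>X\<in>T. X \<subseteq> U))"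

definition herm :: "nat \<Rightarrow> 'a::field ^ 4 \<Rightarrow> 'a ^ 4 \<Rightarrow> 'a" where
  "herm q X Y = X $ 1 * (Y $ 4) ^ q + X $ 4 * (Y $ 1) ^ q
                 - X $ 2 * (Y $ 2) ^ q - X $ 3 * (Y $ 3) ^ q"

definition hermitian_surface :: "nat \<Rightarrow> 'a::field subsp set" where
  "hermitian_surface q = {X. pg_point X \<and> (\<forall>x\<in>X. herm q x x = 0)}"

text \<open>Used for points of \<^const>\<open>hermitian_surface\<close> only; each of them is collinear with itself.\<close>

definition H_collinear :: "nat \<Rightarrow> 'a::field subsp \<Rightarrow> 'a subsp \<Rightarrow> bool" where
  "H_collinear q X Y \<longleftrightarrow> (\<forall>x\<in>X. \<forall>y\<in>Y. herm q x y = 0)"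

definition totally_isotropic_line :: "nat \<Rightarrow> 'a::field subsp \<Rightarrow> bool" where
  "totally_isotropic_line q L \<longleftrightarrow>
     pg_line L \<and> (\<forall>X. pg_point X \<longrightarrow> X \<subseteq> L \<longrightarrow> X \<in> hermitian_surface q)"

definition polar :: "nat \<Rightarrow> 'a::field subsp \<Rightarrow> 'a subsp" where
  "polar q U = {x. \<forall>y\<in>U. herm q x y = 0}"

definition special_set :: "nat \<Rightarrow> 'a::field subsp set \<Rightarrow> bool" where
  "special_set q S \<longleftrightarrow>
     S \<subseteq> hermitian_surface q \<and> finite S \<and> card S = q\<^sup>2 + 1 \<and>
     (\<forall>X \<in> hermitian_surface q - S. card {Y\<in>S. H_collinear q X Y} \<in> {0, 2})"

text \<open>The subfield of order \<open>q\<close> is the set of roots of \<open>x\<^sup>q = x\<close>.\<close>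

definition baer_subfield :: "nat \<Rightarrow> 'a::field set" where
  "baer_subfield q = {c. c ^ q = c}"

definition baer_subline :: "nat \<Rightarrow> 'a::field subsp \<Rightarrow> 'a subsp set \<Rightarrow> bool" where
  "baer_subline q L b \<longleftrightarrow>
     (\<exists>u v. u \<noteq> v \<and> vec.independent {u, v} \<and> vec.span {u, v} = L \<and>
        b = {vec.span {c *s u + d *s v} | c d.
               c \<in> baer_subfield q \<and> d \<in> baer_subfield q \<and> (c, d) \<noteq> (0, 0)})"

text \<open>
  Meaningful for pairwise noncollinear points \<open>A\<close>, \<open>B\<close>, \<open>C\<close> of the surface. Distinct points of a
  special set are always noncollinear when \<open>q\<close> is odd.
\<close>

definition in_perspective :: "nat \<Rightarrow> 'a::field subsp \<Rightarrow> 'a subsp \<Rightarrow> 'a subsp \<Rightarrow> bool" where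
  "in_perspective q A B C \<longleftrightarrow>
     pg_line (vec.span (polar q A \<inter> polar q B \<union> C) \<inter>
              vec.span (polar q B \<inter> polar q C \<union> A) \<inter>
              vec.span (polar q C \<inter> polar q A \<union> B))"

definition field_automorphism :: "('a::field \<Rightarrow> 'a) \<Rightarrow> bool" where
  "field_automorphism \<sigma> \<longleftrightarrow>
     bij \<sigma> \<and> (\<forall>x y. \<sigma> (x + y) = \<sigma> x + \<sigma> y) \<and> (\<forall>x y. \<sigma> (x * y) = \<sigma> x * \<sigma> y)"

definition semilinear_bijection :: "('a::field ^ 4 \<Rightarrow> 'a ^ 4) \<Rightarrow> bool" where
  "semilinear_bijection g \<longleftrightarrow>
     bij g \<and> (\<forall>x y. g (x + y) = g x + g y) \<and>
     (\<exists>\<sigma>. field_automorphism \<sigma> \<and> (\<forall>c x. g (c *s x) = \<sigma> c *s g x))"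

text \<open>
  The group \<open>P\<Gamma>U(4, q)\<close>: a collineation is represented by the induced map \<open>(`) g\<close> on subspaces.
\<close>

definition PGammaU :: "nat \<Rightarrow> ('a::field subsp \<Rightarrow> 'a subsp) set" where
  "PGammaU q = {(`) g | g. semilinear_bijection g \<and>
                  (`) g ` hermitian_surface q = hermitian_surface q}"

definition hermitian_veronesean :: "nat \<Rightarrow> 'a::field subsp set" where
  "hermitian_veronesean q =
     range (\<lambda>x. vec.span {vector [1, x, x ^ q, x ^ (q + 1)]}) \<union> {vec.span {vector [0, 0, 0, 1]}}"

end

theory Submission
  imports Defs
begin

text \<open>
  Choose a basis \<open>u, m, n, p\<close> of two orthogonal hyperbolic pairs with \<open>P = \<langle>p\<rangle>\<close>, \<open>Q = \<langle>u\<rangle>\<close> and \<open>\<ell> = \<langle>p, m\<rangle>\<close>.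
  Distinct points of a special set are noncollinear (\<open>special_noncollinear\<close>), so each point of \<open>\<ell>\<close>
  other than \<open>P\<close> is collinear with exactly one point of \<open>\<S>\<close> besides \<open>P\<close>. Hence \<open>\<S>\<close> consists of \<open>P\<close> and
  the points \<open>(1, f(b), b, g(b))\<close>, one for each \<open>b\<close> in the field (\<open>special_graph_exists\<close>).

  A Baer subline of \<open>\<ell>\<close> through \<open>P\<close> corresponds to an affine line over the subfield of order \<open>q\<close> in the
  parameter \<open>b\<close>, and the coplanarity of the collinear points says that \<open>f\<close> is affine on that line
  (\<open>baer_condition_imp_affine\<close>). Since \<open>f(0) = 0\<close>, the map \<open>f\<close> is linear over the subfield, that
  is, \<open>f(b) = A b + B b\<^sup>q\<close>. The triangle formed by \<open>P\<close>, \<open>Q\<close> and the point with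
  parameter \<open>b\<close> is in perspective only if \<open>g(b)\<close> lies in the subfield (\<open>perspective_imp_fixed\<close>), and
  then isotropy forces \<open>2 g(b) = f(b) b\<^sup>q + f(b)\<^sup>q b\<close>, a quadratic form over the subfield.

  So far the set depends on \<open>A\<close> and \<open>B\<close>. That any three points of a special set have a nonsingular
  Gram matrix (\<open>trace_neq_0\<close>, \<open>triple_neq_0\<close>) gives two restrictions. For triples containing \<open>P\<close>, it says
  that \<open>g\<close> is anisotropic. For the other triples, it forces \<open>A + A\<^sup>q = 0\<close> (\<open>skew_if_special\<close>): if this
  trace were nonzero, a singular triple would be found by solving \<open>s m\<^sup>2 + r n\<^sup>2 = K\<close> over the
  subfield, with an anisotropic left-hand side. Finally, the anisotropy of \<open>g\<close> makes \<open>- B\<^bsup>q+1\<^esup>\<close> a square in the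
  subfield (\<open>minus_norm_is_square\<close>), and from its square root an explicit similarity onto the
  Hermitian Veronesean is obtained (\<open>normal_form_equivalent\<close>).
\<close>

section \<open>Fields of order \<open>q\<^sup>2\<close>\<close>

lemma finite_field_power_CARD:
  fixes x :: "'a::{field,finite}"
  assumes "x \<noteq> 0"
  shows "x ^ (CARD('a) - 1) = 1"
proof -
  have "(\<Prod>y\<in>UNIV-{0}. x * y) = (\<Prod>y\<in>UNIV-{0}. y)"
    by (rule prod.reindex_bij_witness[of _ "\<lambda>y. y / x" "\<lambda>y. x * y"]) (use assms in auto)
  hence "x ^ (CARD('a) - 1) * \<Prod>(UNIV - {0}) = \<Prod>(UNIV - {0})"
    by (simp add: prod.distrib card_Diff_singleton)
  moreover have "\<Prod>(UNIV - {0} :: 'a set) \<noteq> 0"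
    by simp
  ultimately show ?thesis by simp
qed

lemma card_power_eq_le:
  fixes c :: "'a::{field,finite}"
  assumes "n > 0"
  shows "card {x. x ^ n = c} \<le> n"
proof -
  let ?p = "monom 1 n + [:- c:]"
  have d: "degree ?p = n"
    using assms degree_add_eq_left[of "[:- c:]" "monom 1 n"] by (simp add: degree_monom_eq)
  hence "?p \<noteq> 0" using assms by auto
  from card_poly_roots_bound[OF this] show ?thesis
    by (simp add: d poly_monom)
qed

lemma card_le_card_image_mult:
  assumes "finite A" "\<And>y. y \<in> f ` A \<Longrightarrow> card {x\<in>A. f x = y} \<le> d"
  shows "card A \<le> d * card (f ` A)"
proof -
  have "card A = (\<Sum>y\<in>f ` A. card {x\<in>A. f x = y})"
    using sum.image_gen[OF assms(1), of "\<lambda>_. 1::nat" f] by simp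
  also have "\<dots> \<le> (\<Sum>y\<in>f ` A. d)"
    by (rule sum_mono) (rule assms(2))
  finally show ?thesis by (simp add: mult.commute)
qed

text \<open>
  The \<open>d\<close>-th power map on the nonzero elements has fibres of size at most \<open>d\<close>, so its image has at
  least \<open>e\<close> elements; these are all roots of \<open>x\<^sup>e = 1\<close>, which has no more than \<open>e\<close> roots. The choices
  \<open>d = 2\<close>, \<open>d = q + 1\<close> and \<open>d = q - 1\<close> give the square roots, the preimages of the norm and the
  elements of trace zero that are needed below.
\<close>

lemma is_power_if_power_eq_one:
  fixes y :: "'a::{field,finite}"
  assumes "CARD('a) - 1 = d * e" and "y ^ e = 1"
  shows "\<exists>x. x ^ d = y"
proof -
  let ?U = "UNIV - {0::'a}"
  have card2: "CARD('a) \<ge> 2"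
    using card_mono[of "UNIV :: 'a set" "{0,1}"] by simp
  have pos: "d > 0" "e > 0" using assms(1) card2 by (auto intro!: gr0I)
  have cU: "card ?U = d * e"
    using assms(1) by (simp add: card_Diff_singleton)
  have "d * e \<le> d * card ((\<lambda>x. x ^ d) ` ?U)"
    unfolding cU[symmetric]
  proof (rule card_le_card_image_mult)
    fix z
    have "card {x\<in>?U. x ^ d = z} \<le> card {x. x ^ d = z}" by (rule card_mono) auto
    thus "card {x\<in>?U. x ^ d = z} \<le> d" using card_power_eq_le[OF pos(1), of z] by linarith
  qed simp
  hence le: "e \<le> card ((\<lambda>x. x ^ d) ` ?U)" using pos by simp
  have sub: "(\<lambda>x. x ^ d) ` ?U \<subseteq> {z. z ^ e = 1}"
    using finite_field_power_CARD[where 'a='a] assms(1) by (auto simp flip: power_mult)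
  have "(\<lambda>x. x ^ d) ` ?U = {z. z ^ e = 1}"
    by (rule card_seteq[OF _ sub]) (use le card_power_eq_le[OF pos(2), of "1::'a"] in auto)
  hence "y \<in> (\<lambda>x. x ^ d) ` ?U" using assms(2) by simp
  thus ?thesis by auto
qed

text \<open>
  The conjugation \<open>x \<mapsto> x\<^sup>q\<close> is an involution whose fixed points form the subfield of order \<open>q\<close>.
  Membership in that subfield is written \<open>cj x = x\<close> throughout, the norm is \<open>x * cj x\<close>, and
  \<open>cj x = - x\<close> says that \<open>x\<close> has trace zero.
\<close>

locale hermitian_field =
  fixes q :: nat and field_type :: "'a::{field,finite} itself"
  assumes primepow_q: "primepow q" and odd_q: "odd q" and card_K: "CARD('a) = q\<^sup>2"
begin

definition cj :: "'a \<Rightarrow> 'a" where "cj x = x ^ q"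

lemma q_ge_3: "q \<ge> 3"
  using primepow_gt_Suc_0[OF primepow_q] odd_q by (cases "q = 2") auto

lemma CHAR_power: "\<exists>k. q = CHAR('a) ^ k" and prime_CHAR: "prime CHAR('a)"
proof -
  obtain p k where pk: "prime p" "k > 0" "q = p ^ k"
    using primepow_q unfolding primepow_def by auto
  show pr: "prime CHAR('a)"
    using prime_CHAR_semidom[where 'a='a] finite_imp_CHAR_pos[where 'a='a] by simp
  \<comment> \<open>Translation by 1 permutes the field, so the sum of its elements shows that its order
    vanishes in it.\<close>
  have "(\<Sum>x\<in>UNIV. x + 1) = (\<Sum>x\<in>UNIV. x :: 'a)"
    by (rule sum.reindex_bij_witness[of _ "\<lambda>x. x - 1" "\<lambda>x. x + 1"]) auto
  hence "of_nat CARD('a) = (0 :: 'a)" by (simp add: sum.distrib)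
  hence "CHAR('a) dvd p ^ (2 * k)"
    using card_K pk(3) of_nat_eq_0_iff_char_dvd[of "CARD('a)", where 'a='a]
    by (simp add: mult.commute flip: power_mult)
  hence "CHAR('a) dvd p" using pr prime_dvd_power by blast
  hence "CHAR('a) = p" using pr pk(1) by (simp add: primes_dvd_imp_eq)
  thus "\<exists>k. q = CHAR('a) ^ k" using pk(3) by blast
qed

lemma two_neq_0 [simp]: "(2::'a) \<noteq> 0"
proof
  assume "(2::'a) = 0"
  hence "CHAR('a) dvd 2" using of_nat_eq_0_iff_char_dvd[of 2, where 'a='a] by simp
  hence "CHAR('a) = 2" using prime_CHAR by (simp add: primes_dvd_imp_eq)
  thus False using CHAR_power odd_q q_ge_3 by (metis even_power dvd_refl power_0 numeral_le_one_iff semiring_norm(70) gr0I)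
qed

lemma four_neq_0 [simp]: "(4::'a) \<noteq> 0"
  using two_neq_0 by (metis mult_2 mult_eq_0_iff numeral_Bit0)

lemma cj_add [simp]: "cj (x + y) = cj x + cj y"
  unfolding cj_def using CHAR_power freshmans_dream'[OF prime_CHAR] by metis

lemma cj_mult [simp]: "cj (x * y) = cj x * cj y"
  and cj_0 [simp]: "cj 0 = 0" and cj_1 [simp]: "cj 1 = 1"
  and cj_minus [simp]: "cj (- x) = - cj x"
  and cj_divide [simp]: "cj (x / y) = cj x / cj y"
  and cj_power [simp]: "cj (x ^ n) = cj x ^ n"
  and cj_eq_0 [simp]: "cj x = 0 \<longleftrightarrow> x = 0"
  using q_ge_3 odd_q
  by (simp_all add: cj_def power_mult_distrib power_divide power_inverse flip: power_mult)
     (simp add: mult.commute)?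

lemma cj_diff [simp]: "cj (x - y) = cj x - cj y"
  using cj_add[of x "- y"] by simp

lemma cj_cj [simp]: "cj (cj x) = x"
proof (cases "x = 0")
  case False
  have "cj (cj x) = x ^ Suc (CARD('a) - 1)"
    using q_ge_3 by (simp add: cj_def card_K power2_eq_square flip: power_mult)
  thus ?thesis by (simp only: power_Suc finite_field_power_CARD[OF False]) simp
qed simp

lemma cj_numeral [simp]: "cj (numeral n) = numeral n"
proof -
  have "cj (of_nat k) = of_nat k" for k by (induction k) simp_all
  from this[of "numeral n"] show ?thesis by simp
qed

lemma cj_inject [simp]: "cj x = cj y \<longleftrightarrow> x = y"
  by (metis cj_cj)

lemma CARD_minus_1: "CARD('a) - 1 = (q - 1) * (q + 1)"
  by (simp add: card_K power2_eq_square algebra_simps)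

lemma norm_surj:
  assumes "cj y = y"
  shows "\<exists>x. x * cj x = y"
proof (cases "y = 0")
  case False
  have "y * y ^ (q - 1) = y * 1"
    using assms q_ge_3 by (simp add: cj_def flip: power_Suc)
  hence "y ^ (q - 1) = 1" using False by (simp only: mult_cancel_left) simp
  from is_power_if_power_eq_one[OF _ this, of "q + 1"] CARD_minus_1
  obtain x where "x ^ (q + 1) = y" by (metis mult.commute)
  thus ?thesis by (auto simp: cj_def)
qed auto

lemma sqrt_exists:
  assumes "cj y = y"
  shows "\<exists>x. x\<^sup>2 = y"
proof (cases "y = 0")
  case False
  have "y * y ^ (q - 1) = y * 1"
    using assms q_ge_3 by (simp add: cj_def flip: power_Suc)
  hence y1: "y ^ (q - 1) = 1" using False by (simp only: mult_cancel_left) simp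
  obtain k where k: "q + 1 = 2 * k" using odd_q by (metis evenE odd_add odd_one)
  have "y ^ ((q - 1) * k) = 1" by (simp only: power_mult y1 power_one)
  moreover have "CARD('a) - 1 = 2 * ((q - 1) * k)" by (simp only: CARD_minus_1 k mult_ac)
  ultimately show ?thesis using is_power_if_power_eq_one by blast
qed (auto intro: exI[of _ 0])

lemma skew_exists: "\<exists>e. e \<noteq> 0 \<and> cj e = - e"
proof -
  have "(- 1 :: 'a) ^ (q + 1) = 1" using odd_q by simp
  from is_power_if_power_eq_one[OF CARD_minus_1 this]
  obtain e :: 'a where e: "e ^ (q - 1) = - 1" by blast
  have "cj e = e ^ Suc (q - 1)" unfolding cj_def using q_ge_3 by simp
  hence "cj e = - e" by (simp only: power_Suc e) simp
  moreover have "e \<noteq> 0" using e q_ge_3 by (auto simp: power_0_left)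
  ultimately show ?thesis by blast
qed

lemma card_skew_le: "card {x. cj x = - x} \<le> q"
proof -
  let ?p = "monom (1::'a) q + [:0, 1:]"
  have d: "degree ?p = q"
    using q_ge_3 by (simp add: degree_add_eq_left degree_monom_eq)
  hence "?p \<noteq> 0" using q_ge_3 by auto
  from card_poly_roots_bound[OF this] show ?thesis
    by (simp add: d poly_monom cj_def eq_neg_iff_add_eq_0)
qed

end

section \<open>The Hermitian form, its points and hyperbolic bases\<close>

context hermitian_field
begin

abbreviation h :: "'a ^ 4 \<Rightarrow> 'a ^ 4 \<Rightarrow> 'a" where "h \<equiv> herm q"

lemma herm_cj: "h x y = x $ 1 * cj (y $ 4) + x $ 4 * cj (y $ 1) - x $ 2 * cj (y $ 2) - x $ 3 * cj (y $ 3)"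
  by (simp add: herm_def cj_def)

lemma herm_bilinear [simp]:
  "h (x + y) z = h x z + h y z" "h (x - y) z = h x z - h y z" "h (- x) z = - h x z"
  "h (c *s x) z = c * h x z" "h 0 z = 0"
  "h z (x + y) = h z x + h z y" "h z (x - y) = h z x - h z y" "h z (- x) = - h z x"
  "h z (c *s x) = cj c * h z x" "h z 0 = 0"
  by (simp_all add: herm_cj algebra_simps)

lemma herm_sym: "h x y = cj (h y x)"
  by (simp add: herm_cj algebra_simps)

lemma herm_eq_0_sym: "h y x = 0 \<longleftrightarrow> h x y = 0"
  by (subst herm_sym) simp

lemma herm_nondegenerate:
  assumes "\<And>y. h x y = 0"
  shows "x = 0"
proof -
  have "x $ 4 = 0" "x $ 2 = 0" "x $ 3 = 0" "x $ 1 = 0"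
    using assms[of "vector [1,0,0,0]"] assms[of "vector [0,1,0,0]"]
      assms[of "vector [0,0,1,0]"] assms[of "vector [0,0,0,1]"]
    by (simp_all add: herm_cj vector_4)
  thus ?thesis by (simp add: vec_eq_iff forall_4)
qed

lemma span_singleton_iff: "y \<in> vec.span {x} \<longleftrightarrow> (\<exists>c. y = c *s x)"
  for x :: "'a ^ 4"
  by (auto simp: vec.span_singleton)

lemma pg_point_iff: "pg_point U \<longleftrightarrow> (\<exists>x. x \<noteq> 0 \<and> U = vec.span {x})" for U :: "'a subsp"
proof
  assume U: "pg_point U"
  obtain B where B: "B \<subseteq> U" "vec.independent B" "U \<subseteq> vec.span B" "card B = vec.dim U"
    using vec.basis_exists .
  hence "card B = 1" using U by (simp add: pg_point_def)
  then obtain x where x: "B = {x}" by (auto simp: card_1_singleton_iff)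
  have "vec.span B \<subseteq> U" using U B(1) by (simp add: pg_point_def vec.span_minimal)
  hence "U = vec.span {x}" using B(3) x by auto
  moreover have "x \<noteq> 0" using B(2) x by (auto simp: vec.dependent_zero)
  ultimately show "\<exists>x. x \<noteq> 0 \<and> U = vec.span {x}" by blast
next
  assume "\<exists>x. x \<noteq> 0 \<and> U = vec.span {x}"
  then obtain x where x: "x \<noteq> 0" "U = vec.span {x}" by blast
  have "vec.independent {x}" using x(1) by simp
  thus "pg_point U" unfolding pg_point_def x(2)
    using vec.dim_span_eq_card_independent[of "{x}"] by simp
qed

lemma span_in_surface_iff: "vec.span {x} \<in> hermitian_surface q \<longleftrightarrow> x \<noteq> 0 \<and> h x x = 0"
proof -
  have "pg_point (vec.span {x}) \<longleftrightarrow> x \<noteq> 0"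
    using vec.dim_span_eq_card_independent[of "{x}"] pg_point_iff
    by (auto simp: pg_point_def)
  thus ?thesis
    by (auto simp: hermitian_surface_def span_singleton_iff intro: vec.span_base)
qed

lemma surface_cases:
  assumes "X \<in> hermitian_surface q"
  obtains x where "x \<noteq> 0" "h x x = 0" "X = vec.span {x}"
  using assms span_in_surface_iff by (auto simp: hermitian_surface_def pg_point_iff)

lemma H_collinear_span: "H_collinear q (vec.span {x}) (vec.span {y}) \<longleftrightarrow> h x y = 0"
  by (auto simp: H_collinear_def span_singleton_iff intro: vec.span_base)

lemma span_eq_iff:
  fixes x y :: "'a ^ 4"
  assumes "x \<noteq> 0"
  shows "vec.span {x} = vec.span {y} \<longleftrightarrow> (\<exists>c. x = c *s y)"
proof
  assume "vec.span {x} = vec.span {y}"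
  thus "\<exists>c. x = c *s y" using span_singleton_iff vec.span_base by blast
next
  assume "\<exists>c. x = c *s y"
  then obtain c where c: "x = c *s y" "c \<noteq> 0" using assms by auto
  hence "y = (1 / c) *s x" by simp
  hence "x \<in> vec.span {y}" "y \<in> vec.span {x}" using c span_singleton_iff by blast+
  thus "vec.span {x} = vec.span {y}"
    by (simp add: subset_antisym vec.span_minimal)
qed

end

text \<open>
  A basis of two orthogonal hyperbolic pairs \<open>(u, p)\<close> and \<open>(m, n)\<close>. With respect to it the
  totally isotropic line through \<open>p\<close> and \<open>m\<close> and the noncollinear points \<open>p\<close> and \<open>u\<close> become
  coordinate subspaces. The value \<open>- 1\<close> on \<open>(m, n)\<close> gives the products of the two middle coordinates
  the sign that they have in the equation of the surface.
\<close>

locale hermitian_frame = hermitian_field q field_type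
  for q and field_type :: "'a::{field,finite} itself" +
  fixes p u m n :: "'a ^ 4"
  assumes gram_eqs: "herm q p p = 0" "herm q u u = 0" "herm q u p = 1"
     "herm q m m = 0" "herm q n n = 0" "herm q m n = - 1"
     "herm q m p = 0" "herm q m u = 0" "herm q n p = 0" "herm q n u = 0"
begin

lemma gram [simp]:
  "h p p = 0" "h u u = 0" "h u p = 1" "h p u = 1"
  "h m m = 0" "h n n = 0" "h m n = - 1" "h n m = - 1"
  "h m p = 0" "h m u = 0" "h n p = 0" "h n u = 0"
  "h p m = 0" "h u m = 0" "h p n = 0" "h u n = 0"
  using gram_eqs herm_sym[of p u] herm_sym[of n m] herm_sym[of p m] herm_sym[of u m]
    herm_sym[of p n] herm_sym[of u n] by simp_all

definition pt :: "'a \<Rightarrow> 'a \<Rightarrow> 'a \<Rightarrow> 'a \<Rightarrow> 'a ^ 4" where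
  "pt x y z w = x *s u + y *s m + z *s n + w *s p"

lemma herm_pt [simp]:
  "h (pt x y z w) p = x" "h (pt x y z w) n = - y" "h (pt x y z w) m = - z" "h (pt x y z w) u = w"
  "h (pt x y z w) (pt x' y' z' w') = x * cj w' + w * cj x' - y * cj z' - z * cj y'"
  by (simp_all add: pt_def)

lemma pt_eq_iff: "pt x y z w = pt x' y' z' w' \<longleftrightarrow> x = x' \<and> y = y' \<and> z = z' \<and> w = w'"
proof
  assume eq: "pt x y z w = pt x' y' z' w'"
  show "x = x' \<and> y = y' \<and> z = z' \<and> w = w'"
    using arg_cong[OF eq, of "\<lambda>v. h v p"] arg_cong[OF eq, of "\<lambda>v. h v n"]
      arg_cong[OF eq, of "\<lambda>v. h v m"] arg_cong[OF eq, of "\<lambda>v. h v u"] by simp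
qed simp

text \<open>
  The coordinates of a vector are recovered by pairing it with the basis vectors, so the coordinate
  map is injective; on a finite space it is then surjective.
\<close>

lemma pt_surj: "\<exists>x y z w. v = pt x y z w"
proof -
  let ?f = "\<lambda>v :: 'a ^ 4. pt (v $ 1) (v $ 2) (v $ 3) (v $ 4)"
  have "inj ?f"
  proof (rule injI)
    fix v w :: "'a ^ 4"
    assume "?f v = ?f w"
    thus "v = w" unfolding pt_eq_iff by (simp add: vec_eq_iff forall_4)
  qed
  hence "surj ?f" by (simp add: finite_UNIV_inj_surj)
  from surjD[OF this, of v] show ?thesis by blast
qed

lemma pt_linear:
  "pt x y z w + pt x' y' z' w' = pt (x + x') (y + y') (z + z') (w + w')"
  "pt x y z w - pt x' y' z' w' = pt (x - x') (y - y') (z - z') (w - w')"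
  "c *s pt x y z w = pt (c * x) (c * y) (c * z) (c * w)"
  by (intro vec_eq_iff[THEN iffD2] allI; simp add: pt_def algebra_simps)+

lemma zero_pt: "0 = pt 0 0 0 0"
  by (simp add: pt_def)

end

context hermitian_field
begin

text \<open>
  A vector not orthogonal to \<open>a\<close> is rescaled and then made isotropic by subtracting half its
  length times \<open>a\<close>, where halving uses that \<open>q\<close> is odd.
\<close>

lemma hyperbolic_partner:
  assumes "a \<noteq> 0" "h a a = 0"
  shows "\<exists>u. h u u = 0 \<and> h u a = 1"
proof -
  obtain v where "h a v \<noteq> 0" using herm_nondegenerate assms(1) by blast
  define w where "w = (1 / h v a) *s v"
  have w: "h w a = 1" "h a w = 1"
    using \<open>h a v \<noteq> 0\<close> herm_eq_0_sym[of a v] herm_sym[of a w] by (simp_all add: w_def)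
  have "cj (h w w) = h w w" using herm_sym[of w w] by simp
  hence "h (w - (h w w / 2) *s a) (w - (h w w / 2) *s a) = 0"
    using w assms(2) by simp
  moreover have "h (w - (h w w / 2) *s a) a = 1" using w assms(2) by simp
  ultimately show ?thesis by blast
qed

text \<open>
  The projection \<open>m\<close> of \<open>b\<close> along \<open>p\<close> lies in the orthogonal complement of the hyperbolic
  pair \<open>(u, p)\<close> and spans the same line with \<open>p\<close> as \<open>b\<close>. A hyperbolic partner of \<open>m\<close> is projected
  into that complement and corrected by a multiple of \<open>m\<close>.
\<close>

lemma frame_exists:
  assumes "h p p = 0" "h u u = 0" "h u p = 1"
    and b: "h b b = 0" "h b p = 0" "b \<notin> vec.span {p}"
  defines "m \<equiv> b - h b u *s p"
  shows "\<exists>n. hermitian_frame q p u m n"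
proof -
  have up: "h p u = 1" using assms(3) herm_sym[of p u] by simp
  have pb: "h p b = 0" using b(2) herm_eq_0_sym by blast
  have m: "h m m = 0" "h m p = 0" "h m u = 0"
    using assms up pb by (simp_all add: m_def)
  have m': "h p m = 0" "h u m = 0" using m herm_eq_0_sym by blast+
  have "m \<noteq> 0"
    using b(3) span_singleton_iff[of b p] by (auto simp: m_def)
  then obtain v where v: "h v v = 0" "h v m = 1" using hyperbolic_partner[OF _ m(1)] by blast
  define w where "w = v - h v u *s p - h v p *s u"
  have w: "h w p = 0" "h w u = 0" "h w m = 1"
    using assms(1-3) up v m' by (simp_all add: w_def)
  have w': "h p w = 0" "h u w = 0" "h m w = 1"
    using w herm_eq_0_sym herm_sym[of m w] by simp_all
  have r: "cj (h w w) = h w w" using herm_sym[of w w] by simp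
  define n where "n = (h w w / 2) *s m - w"
  have "hermitian_frame q p u m n"
    by unfold_locales (use assms(1-3) m m' w w' r in \<open>simp_all add: n_def\<close>)
  thus ?thesis ..
qed

end

section \<open>Noncollinearity of the points of a special set\<close>

context hermitian_field
begin

lemma special_surface:
  assumes "special_set q S" "vec.span {r} \<in> S"
  shows "r \<noteq> 0" "h r r = 0"
  using assms span_in_surface_iff unfolding special_set_def by blast+

lemma special_cases:
  assumes "special_set q S" "R \<in> S"
  obtains r where "r \<noteq> 0" "h r r = 0" "R = vec.span {r}"
proof -
  have "R \<in> hermitian_surface q" using assms unfolding special_set_def by blast
  thus thesis by (rule surface_cases) (rule that)
qed

lemma special_count:
  assumes "special_set q S" "x \<noteq> 0" "h x x = 0" "vec.span {x} \<notin> S"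
  shows "card {R\<in>S. H_collinear q (vec.span {x}) R} \<in> {0, 2}"
  using assms span_in_surface_iff[of x] unfolding special_set_def by blast

text \<open>
  Of the two values allowed in the definition of a special set, mostly the upper bound is used.
\<close>

lemma special_third:
  assumes S: "special_set q S" and x: "x \<noteq> 0" "h x x = 0" "vec.span {x} \<notin> S"
    and A: "A = vec.span {a}" "A \<in> S" "h x a = 0" and B: "B = vec.span {b}" "B \<in> S" "h x b = 0"
    and "A \<noteq> B" and R: "R = vec.span {r}" "R \<in> S" "h x r = 0"
  shows "R = A \<or> R = B"
proof -
  let ?N = "{R\<in>S. H_collinear q (vec.span {x}) R}"
  have fin: "finite ?N" using S unfolding special_set_def by simp
  have "{A, B, R} \<subseteq> ?N" using A B R by (auto simp: H_collinear_span)
  hence "card {A, B, R} \<le> card ?N" using fin card_mono by blast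
  moreover have "card ?N \<le> 2"
    using special_count[OF S x] by (elim insertE emptyE) linarith+
  ultimately have "card {A, B, R} \<le> 2" by linarith
  thus ?thesis using \<open>A \<noteq> B\<close> by (auto simp: card_insert_if split: if_splits)
qed

text \<open>
  Otherwise the set contains the \<open>q\<^sup>2 + 1\<close> points of the line and hence is equal to it. A point of the
  surface off a totally isotropic line is collinear with exactly one point of that line, and one is
  not an allowed number.
\<close>

lemma special_not_line:
  assumes S: "special_set q S" and A: "vec.span {a} \<in> S" and B: "vec.span {b} \<in> S"
    and AB: "vec.span {a} \<noteq> vec.span {b}" and ab: "h a b = 0"
  shows "\<exists>x\<in>vec.span {a, b}. x \<noteq> 0 \<and> vec.span {x} \<notin> S"
proof (rule ccontr)
  assume "\<not> ?thesis"
  hence sub: "\<And>x. x \<in> vec.span {a, b} \<Longrightarrow> x \<noteq> 0 \<Longrightarrow> vec.span {x} \<in> S" by blast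
  note a = special_surface[OF S A] and b = special_surface[OF S B]
  have ba: "h b a = 0" using ab herm_eq_0_sym by blast
  have ind: "b + t *s a \<noteq> c *s a" for t c
  proof
    assume "b + t *s a = c *s a"
    hence "b = (c - t) *s a" by (simp add: vec.scale_left_diff_distrib algebra_simps)
    hence "vec.span {b} = vec.span {a}" using span_eq_iff[OF b(1), of a] by blast
    thus False using AB by simp
  qed
  have ind0: "b + t *s a \<noteq> 0" for t using ind[of t 0] by simp
  let ?L = "insert (vec.span {a}) (range (\<lambda>t. vec.span {b + t *s a}))"
  have L: "?L \<subseteq> S"
    using A ind0 by (auto intro!: sub vec.span_add vec.span_scale intro: vec.span_base)
  have "inj (\<lambda>t. vec.span {b + t *s a})"
  proof (rule injI)
    fix t s assume "vec.span {b + t *s a} = vec.span {b + s *s a}"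
    then obtain c where c: "b + t *s a = c *s (b + s *s a)"
      using span_eq_iff[OF ind0[of t]] by blast
    show "t = s"
    proof (cases "c = 1")
      case True
      hence "(t - s) *s a = 0" using c by (simp add: vec.scale_left_diff_distrib)
      thus ?thesis using a(1) by simp
    next
      case False
      have "(1 - c) *s b = (c * s - t) *s a"
        using c by (simp add: vec.scale_left_diff_distrib vec.scale_right_distrib algebra_simps)
      hence "(1 / (1 - c)) *s ((1 - c) *s b) = (1 / (1 - c)) *s ((c * s - t) *s a)" by simp
      hence "b + 0 *s a = (1 / (1 - c) * (c * s - t)) *s a"
        using False by (simp only: vec.scale_scale) simp
      thus ?thesis using ind by blast
    qed
  qed
  hence "card (range (\<lambda>t. vec.span {b + t *s a})) = q\<^sup>2"
    using card_K by (simp add: card_image)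
  moreover have "vec.span {a} \<notin> range (\<lambda>t. vec.span {b + t *s a})"
  proof
    assume "vec.span {a} \<in> range (\<lambda>t. vec.span {b + t *s a})"
    then obtain t where "vec.span {b + t *s a} = vec.span {a}" by auto
    thus False using span_eq_iff[OF ind0[of t], of a] ind by blast
  qed
  ultimately have "card ?L = card S" using S by (simp add: special_set_def)
  hence SL: "S = ?L" using L S card_subset_eq[of S ?L] by (simp add: special_set_def)
  obtain u where u: "h u u = 0" "h u a = 1" using hyperbolic_partner[OF a] by blast
  have u0: "u \<noteq> 0" using u(2) by auto
  have nl: "vec.span {u} \<notin> S"
  proof
    assume "vec.span {u} \<in> S"
    then obtain x where x: "vec.span {u} = vec.span {x}" "h x a = 0"
      unfolding SL using a(2) ba by auto
    then obtain c where "u = c *s x" using span_eq_iff[OF u0] by blast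
    thus False using x(2) u(2) by simp
  qed
  let ?t = "- h u b"
  \<comment> \<open>As u is not orthogonal to a, exactly one of these points is collinear with u.\<close>
  have au: "h u (b + t *s a) = 0 \<longleftrightarrow> t = cj ?t" for t
    using u(2) by (auto simp: add_eq_0_iff) (metis cj_cj cj_minus)
  have "R \<in> S \<and> H_collinear q (vec.span {u}) R \<longleftrightarrow> R = vec.span {b + cj ?t *s a}" for R
  proof
    assume R: "R \<in> S \<and> H_collinear q (vec.span {u}) R"
    hence "R \<noteq> vec.span {a}" using u(2) H_collinear_span[of u a] by auto
    then obtain t where t: "R = vec.span {b + t *s a}" using R SL by auto
    hence "t = cj ?t" using R au[of t] H_collinear_span[of u "b + t *s a"] by blast
    thus "R = vec.span {b + cj ?t *s a}" using t by simp
  next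
    assume R: "R = vec.span {b + cj ?t *s a}"
    show "R \<in> S \<and> H_collinear q (vec.span {u}) R"
      using SL H_collinear_span[of u "b + cj ?t *s a"] au[of "cj ?t"] unfolding R by blast
  qed
  hence "{R\<in>S. H_collinear q (vec.span {u}) R} = {vec.span {b + cj ?t *s a}}" by blast
  hence "card {R\<in>S. H_collinear q (vec.span {u}) R} = 1" by simp
  thus False using special_count[OF S u0 u(1) nl] by simp
qed

text \<open>
  A point of the line outside the set is collinear with every point of the line, hence with every
  point of the set on the line.
\<close>

lemma special_line_two_points:
  assumes S: "special_set q S" and A: "vec.span {a} \<in> S" and B: "vec.span {b} \<in> S"
    and AB: "vec.span {a} \<noteq> vec.span {b}" and ab: "h a b = 0"
    and R: "vec.span {r} \<in> S" "r \<in> vec.span {a, b}"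
  shows "vec.span {r} = vec.span {a} \<or> vec.span {r} = vec.span {b}"
proof -
  obtain x where x: "x \<in> vec.span {a, b}" "x \<noteq> 0" "vec.span {x} \<notin> S"
    using special_not_line[OF S A B AB ab] by blast
  note a = special_surface[OF S A] and b = special_surface[OF S B]
  have ba: "h b a = 0" using ab herm_eq_0_sym by blast
  have span: "\<exists>c d. y = c *s a + d *s b" if "y \<in> vec.span {a, b}" for y
    using that by (auto simp: vec.span_insert span_singleton_iff) (metis add.commute diff_add_cancel)
  obtain c d where c: "x = c *s a + d *s b" using span x(1) by blast
  obtain c' d' where c': "r = c' *s a + d' *s b" using span R(2) by blast
  show ?thesis
    by (rule special_third[OF S x(2) _ x(3) refl A _ refl B _ AB refl R(1)])
       (simp_all add: c c' a b ab ba)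
qed

text \<open>
  There are \<open>q + 1\<close> totally isotropic lines through a point of the surface, and by the previous
  lemma each of them contains at most one further point of the set. In a frame at \<open>a\<close>, the line joining
  \<open>a\<close> to a collinear point with middle coordinates \<open>(y, z)\<close> is determined by the ratio \<open>z / y\<close>, which is
  infinite or of trace zero.
\<close>

lemma card_special_collinear_le:
  assumes S: "special_set q S" and A: "vec.span {a} \<in> S" and B: "vec.span {b} \<in> S"
    and AB: "vec.span {a} \<noteq> vec.span {b}" and ab: "h a b = 0"
  shows "card {R\<in>S - {vec.span {a}}. H_collinear q (vec.span {a}) R} \<le> q + 1"
proof -
  let ?N = "{R\<in>S - {vec.span {a}}. H_collinear q (vec.span {a}) R}"
  note a = special_surface[OF S A] and b = special_surface[OF S B]
  obtain u where u: "h u u = 0" "h u a = 1" using hyperbolic_partner[OF a] by blast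
  have bn: "b \<notin> vec.span {a}" using AB span_eq_iff[OF b(1), of a] span_singleton_iff by blast
  have ba: "h b a = 0" using ab herm_eq_0_sym by blast
  from frame_exists[OF a(2) u b(2) ba bn] obtain m n where "hermitian_frame q a u m n" by blast
  then interpret fr: hermitian_frame q "TYPE('a)" a u m n .
  have "\<forall>R\<in>S. \<exists>r. R = vec.span {r}" using special_cases[OF S] by metis
  then obtain g where g: "\<And>R. R \<in> S \<Longrightarrow> R = vec.span {g R}" by metis
  \<comment> \<open>The value None stands for the infinite ratio.\<close>
  define f where "f r = (if h r n = 0 then None else Some (h r m / h r n))" for r
  have ra: "h (g R) a = 0" "h (g R) (g R) = 0" "R \<in> S" "g R \<noteq> 0" if "R \<in> ?N" for R
  proof -
    have "H_collinear q (vec.span {a}) (vec.span {g R})" using that g[of R] by simp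
    thus "h (g R) a = 0" using H_collinear_span herm_eq_0_sym by blast
    show "R \<in> S" using that by simp
    thus "h (g R) (g R) = 0" "g R \<noteq> 0" using special_surface[OF S, of "g R"] g[of R] by simp_all
  qed
  have inj: "inj_on (\<lambda>R. f (g R)) ?N"
  proof (rule inj_onI)
    fix R R' assume R: "R \<in> ?N" "R' \<in> ?N" and eq: "f (g R) = f (g R')"
    obtain x y z w where r: "g R = fr.pt x y z w" using fr.pt_surj by blast
    obtain x' y' z' w' where r': "g R' = fr.pt x' y' z' w'" using fr.pt_surj by blast
    have x0: "x = 0" "x' = 0" using ra(1)[OF R(1)] ra(1)[OF R(2)] r r' by simp_all
    have yz: "y \<noteq> 0 \<or> z \<noteq> 0"
    proof (rule ccontr)
      assume "\<not> ?thesis"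
      hence "g R = w *s a" using r x0 by (simp add: fr.pt_def)
      hence "R = vec.span {a}" using span_eq_iff[OF ra(4)[OF R(1)], of a] g[OF ra(3)[OF R(1)]] by auto
      thus False using R(1) by simp
    qed
    have "\<exists>k. y' = k * y \<and> z' = k * z"
    proof (cases "y = 0")
      case True
      thus ?thesis using eq yz r r' by (intro exI[of _ "z' / z"]) (auto simp: f_def split: if_splits)
    next
      case False
      thus ?thesis using eq r r' by (intro exI[of _ "y' / y"]) (auto simp: f_def field_simps split: if_splits)
    qed
    then obtain k where k: "y' = k * y" "z' = k * z" by blast
    have gR': "g R' = (w' - k * w) *s a + k *s g R"
      unfolding r r' x0 k fr.pt_def by (simp add: vec_eq_iff algebra_simps)
    have "g R' \<in> vec.span {a, g R}"
      unfolding gR' by (intro vec.span_add vec.span_scale vec.span_base) simp_all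
    moreover have "h a (g R) = 0" using ra(1)[OF R(1)] herm_eq_0_sym by blast
    moreover have "vec.span {g R} \<in> S" "vec.span {g R'} \<in> S" "vec.span {a} \<noteq> vec.span {g R}"
      using R g[OF ra(3)[OF R(1)]] g[OF ra(3)[OF R(2)]] by auto
    ultimately have "vec.span {g R'} = vec.span {a} \<or> vec.span {g R'} = vec.span {g R}"
      using special_line_two_points[OF S A, of "g R" "g R'"] by blast
    hence "R' = vec.span {a} \<or> R' = R"
      using g[OF ra(3)[OF R(1)]] g[OF ra(3)[OF R(2)]] by simp
    thus "R = R'" using R(2) by auto
  qed
  have "(\<lambda>R. f (g R)) ` ?N \<subseteq> insert None (Some ` {t. cj t = - t})"
  proof
    fix t assume "t \<in> (\<lambda>R. f (g R)) ` ?N"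
    then obtain R where R: "R \<in> ?N" "t = f (g R)" by blast
    obtain x y z w where r: "g R = fr.pt x y z w" using fr.pt_surj by blast
    have "x = 0" using ra(1)[OF R(1)] r by simp
    hence yz: "cj z * y = (- z) * cj y" using ra(2)[OF R(1)] r
      by (simp add: mult.commute neg_eq_iff_add_eq_0 eq_neg_iff_add_eq_0)
    show "t \<in> insert None (Some ` {t. cj t = - t})"
    proof (cases "y = 0")
      case True
      thus ?thesis using R(2) r by (simp add: f_def)
    next
      case False
      hence "cj z / cj y = (- z) / y" using yz by (subst frac_eq_eq) simp_all
      hence "cj (z / y) = - (z / y)" by simp
      moreover have "t = Some (z / y)" using R(2) r False by (simp add: f_def)
      ultimately show ?thesis by blast
    qed
  qed
  from card_inj_on_le[OF inj this finite]
  have "card ?N \<le> card (insert None (Some ` {t. cj t = - t}))" .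
  also have "\<dots> \<le> q + 1" using card_skew_le by (simp add: card_insert_if card_image)
  finally show ?thesis .
qed

text \<open>
  Let \<open>a\<close> and \<open>b\<close> be collinear points of the set. Every other point of the set is collinear with some
  point of the line \<open>ab\<close>; that point belongs to the set, because otherwise it would be
  collinear with three points of the set, and so it is \<open>a\<close> or \<open>b\<close>. But \<open>a\<close> and \<open>b\<close> together have
  at most \<open>2(q + 1)\<close> collinear points in the set, fewer than \<open>q\<^sup>2 + 1\<close>.
\<close>

lemma special_noncollinear:
  assumes S: "special_set q S" and A: "vec.span {a} \<in> S" and B: "vec.span {b} \<in> S"
    and AB: "vec.span {a} \<noteq> vec.span {b}"
  shows "h a b \<noteq> 0"
proof
  assume ab: "h a b = 0"
  note a = special_surface[OF S A] and b = special_surface[OF S B]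
  have ba: "h b a = 0" using ab herm_eq_0_sym by blast
  let ?N = "\<lambda>a. {R\<in>S - {vec.span {a}}. H_collinear q (vec.span {a}) R}"
  have "S \<subseteq> ?N a \<union> ?N b"
  proof
    fix R assume R: "R \<in> S"
    obtain r where r: "h r r = 0" "R = vec.span {r}" using special_cases[OF S R] by blast
    \<comment> \<open>The point of the line that is collinear with R.\<close>
    define y where "y = h b r *s a - h a r *s b"
    have y: "h y y = 0" "h y r = 0" "h y a = 0" "h y b = 0"
      by (simp_all add: y_def a b ab ba)
    have "h a r = 0 \<or> h b r = 0"
    proof (cases "y = 0")
      case True
      show ?thesis
      proof (rule disjCI)
        assume "h b r \<noteq> 0"
        hence "a = (h a r / h b r) *s b"
          using arg_cong[OF True, of "\<lambda>v. (1 / h b r) *s v"]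
          by (simp add: y_def vec.scale_right_diff_distrib)
        thus "h a r = 0" using AB span_eq_iff[OF a(1), of b] by blast
      qed
    next
      case False
      show ?thesis
      proof (cases "vec.span {y} \<in> S")
        case True
        have "y \<in> vec.span {a, b}" unfolding y_def
          by (auto intro: vec.span_diff vec.span_scale vec.span_base)
        from special_line_two_points[OF S A B AB ab True this]
        have "(\<exists>c. y = c *s a) \<or> (\<exists>c. y = c *s b)" using span_eq_iff[OF False] by blast
        thus ?thesis using y(2) False by auto
      next
        case nS: False
        have "R = vec.span {a} \<or> R = vec.span {b}"
          by (rule special_third[OF S False y(1) nS refl A y(3) refl B y(4) AB r(2) R y(2)])
        moreover have "r \<noteq> 0" using special_surface(1)[OF S, of r] R r(2) by simp
        ultimately have "(\<exists>c. r = c *s a) \<or> (\<exists>c. r = c *s b)"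
          using r(2) span_eq_iff[of r] by simp
        thus ?thesis using a b by auto
      qed
    qed
    hence disj: "H_collinear q (vec.span {a}) R \<or> H_collinear q (vec.span {b}) R"
      unfolding r(2) H_collinear_span .
    have AB': "H_collinear q (vec.span {a}) (vec.span {b})" "H_collinear q (vec.span {b}) (vec.span {a})"
      using ab ba H_collinear_span by blast+
    show "R \<in> ?N a \<union> ?N b"
    proof (cases "R = vec.span {a} \<or> R = vec.span {b}")
      case True
      thus ?thesis using AB AB' A B by blast
    next
      case False
      thus ?thesis using R disj by blast
    qed
  qed
  moreover have fin: "finite S" using S by (simp add: special_set_def)
  ultimately have "card S \<le> card (?N a \<union> ?N b)" by (intro card_mono) auto
  also have "\<dots> \<le> card (?N a) + card (?N b)" by (rule card_Un_le)
  also have "\<dots> \<le> (q + 1) + (q + 1)"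
    using card_special_collinear_le[OF S A B AB ab]
      card_special_collinear_le[OF S B A AB[symmetric] ba] by linarith
  finally have "q\<^sup>2 + 1 \<le> 2 * q + 2" using S by (simp add: special_set_def)
  moreover have "3 * q \<le> q\<^sup>2" using q_ge_3 by (simp add: power2_eq_square)
  ultimately show False using q_ge_3 by linarith
qed

text \<open>
  Outside the set this is the bound of two; inside the set it follows from noncollinearity.
\<close>

lemma special_no_common_neighbour:
  assumes S: "special_set q S" and x: "x \<noteq> 0" "h x x = 0"
    and R: "vec.span {r1} \<in> S" "vec.span {r2} \<in> S" "vec.span {r3} \<in> S"
    and d: "vec.span {r1} \<noteq> vec.span {r2}" "vec.span {r2} \<noteq> vec.span {r3}" "vec.span {r3} \<noteq> vec.span {r1}"
    and hx: "h x r1 = 0" "h x r2 = 0" "h x r3 = 0"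
  shows False
proof (cases "vec.span {x} \<in> S")
  case True
  show False
  proof (cases "vec.span {x} = vec.span {r1}")
    case eq: True
    thus False using special_noncollinear[OF S True R(2)] d hx by simp
  next
    case False
    thus False using special_noncollinear[OF S True R(1)] hx by simp
  qed
next
  case False
  from special_third[OF S x False refl R(1) hx(1) refl R(2) hx(2) d(1) refl R(3) hx(3)]
  show False using d by simp
qed

end

section \<open>A special set as a graph over the field\<close>

text \<open>
  The points of a special set other than \<open>P\<close> are not collinear with \<open>P\<close>, so they can be normalised
  to have first coordinate 1. Their third coordinate \<open>b\<close> runs through the field exactly once.
\<close>

locale special_graph = hermitian_frame q field_type p u m n
  for q and field_type :: "'a::{field,finite} itself" and p u m n :: "'a ^ 4" +
  fixes S :: "'a subsp set" and f g :: "'a \<Rightarrow> 'a"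
  assumes special: "special_set q S"
    and graph: "S = insert (vec.span {p}) (range (\<lambda>b. vec.span {pt 1 (f b) b (g b)}))"
begin

definition r :: "'a \<Rightarrow> 'a ^ 4" where "r b = pt 1 (f b) b (g b)"

lemma r_in: "vec.span {r b} \<in> S" and p_in: "vec.span {p} \<in> S"
  by (simp_all add: graph r_def)

lemma herm_r [simp]: "h (r b) p = 1" "h (r b) m = - b" "h (r b) u = g b" "h (r b) n = - f b"
    "h p (r b) = 1"
  using herm_sym[of p "r b"] by (simp_all add: r_def)

lemma herm_r_r: "h (r b) (r b') = cj (g b') + g b - f b * cj b' - b * cj (f b')"
  by (simp add: r_def)

lemma r_neq_0: "r b \<noteq> 0"
  by (simp add: r_def zero_pt pt_eq_iff)

lemma span_r_inject: "vec.span {r b} = vec.span {r b'} \<longleftrightarrow> b = b'"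
proof
  assume "vec.span {r b} = vec.span {r b'}"
  moreover note r_neq_0
  ultimately obtain c where c: "r b = c *s r b'" using span_eq_iff by blast
  have "c = 1" using arg_cong[OF c, of "\<lambda>x. h x p"] by simp
  thus "b = b'" using arg_cong[OF c, of "\<lambda>x. h x m"] by simp
qed simp

lemma span_r_neq_p: "vec.span {r b} \<noteq> vec.span {p}"
proof
  assume "vec.span {r b} = vec.span {p}"
  moreover note r_neq_0
  ultimately obtain c where c: "r b = c *s p" using span_eq_iff by blast
  have "h (r b) p = 0" unfolding c by simp
  thus False by simp
qed

lemma r_isotropic: "h (r b) (r b) = 0"
  using special_surface[OF special r_in] by simp

text \<open>
  The Gram matrix of \<open>p\<close>, \<open>r b\<close>, \<open>r b'\<close> has determinant \<open>h (r b) (r b') + h (r b') (r b)\<close>. If it vanishes,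
  then its null vector gives an isotropic vector orthogonal to three points of the set.
\<close>

lemma trace_neq_0:
  assumes "b \<noteq> b'"
  shows "h (r b) (r b') + h (r b') (r b) \<noteq> 0"
proof
  assume tr: "h (r b) (r b') + h (r b') (r b) = 0"
  define x where "x = r b' - r b - h (r b') (r b) *s p"
  have x: "h x p = 0" "h x (r b) = 0" "h x (r b') = 0"
    using tr by (simp_all add: x_def r_isotropic add_eq_0_iff)
  have "h x m = b - b'" by (simp add: x_def)
  hence "x \<noteq> 0" using assms by auto
  moreover have "h x x = h x (r b') - h x (r b) - cj (h (r b') (r b)) * h x p"
    by (subst (2) x_def) simp
  hence "h x x = 0" using x by simp
  ultimately show False
    using special_no_common_neighbour[OF special _ _ p_in r_in[of b] r_in[of b']] x
      span_r_neq_p span_r_inject assms by metis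
qed

text \<open>
  The expression is the determinant of the Gram matrix of \<open>r b1\<close>, \<open>r b2\<close>, \<open>r b3\<close>. If it vanishes, the
  null vector of the Gram matrix gives an isotropic vector orthogonal to all three points. It can be
  zero only if the three points lie on a line, and then an isotropic vector orthogonal to two of
  them is orthogonal to the third.
\<close>

lemma triple_neq_0:
  assumes d: "b1 \<noteq> b2" "b2 \<noteq> b3" "b3 \<noteq> b1"
  shows "h (r b1) (r b2) * h (r b2) (r b3) * h (r b3) (r b1)
       + h (r b2) (r b1) * h (r b3) (r b2) * h (r b1) (r b3) \<noteq> 0"
proof
  let ?h = "\<lambda>b b'. h (r b) (r b')"
  assume eq: "?h b1 b2 * ?h b2 b3 * ?h b3 b1 + ?h b2 b1 * ?h b3 b2 * ?h b1 b3 = 0"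
  have no: False if "y \<noteq> 0" "h y y = 0" "h y (r b1) = 0" "h y (r b2) = 0" "h y (r b3) = 0" for y
    using special_no_common_neighbour[OF special that(1,2) r_in[of b1] r_in[of b2] r_in[of b3]]
      that d by (simp add: span_r_inject)
  have nz: "?h b1 b2 \<noteq> 0" "?h b2 b1 \<noteq> 0"
    using special_noncollinear[OF special r_in r_in] span_r_inject d by blast+
  define c1 c2 where "c1 = ?h b3 b2 / ?h b1 b2" and "c2 = ?h b3 b1 / ?h b2 b1"
  define x where "x = r b3 - c1 *s r b1 - c2 *s r b2"
  have x12: "h x (r b1) = 0" "h x (r b2) = 0"
    using nz by (simp_all add: x_def c1_def c2_def r_isotropic)
  have "?h b1 b2 * ?h b2 b1 * h x (r b3)
      = - (?h b1 b2 * ?h b2 b3 * ?h b3 b1 + ?h b2 b1 * ?h b3 b2 * ?h b1 b3)"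
    using nz by (simp add: x_def c1_def c2_def r_isotropic field_simps)
  hence x3: "h x (r b3) = 0" using eq nz by simp
  have "h x x = h x (r b3) - cj c1 * h x (r b1) - cj c2 * h x (r b2)"
    by (subst (2) x_def) simp
  hence xx: "h x x = 0" using x12 x3 by simp
  have "x = 0" using no xx x12 x3 by blast
  hence r3: "r b3 = c1 *s r b1 + c2 *s r b2" by (simp add: x_def algebra_simps)
  \<comment> \<open>X is the point of the line pm collinear with the first point, and y the point on the
    totally isotropic line joining these two that is collinear with the second point.\<close>
  define X where "X = m + cj b1 *s p"
  have X: "h X X = 0" "h X (r b1) = 0" "h X (r b2) = cj b1 - cj b2" "h X p = 0"
    using herm_sym[of m "r b1"] herm_sym[of m "r b2"] by (simp_all add: X_def)
  define y where "y = h X (r b2) *s r b1 - ?h b1 b2 *s X"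
  have "h (r b1) X = 0" using X(2) herm_eq_0_sym by blast
  hence y: "h y (r b1) = 0" "h y (r b2) = 0" "h y X = 0"
    using X by (simp_all add: y_def r_isotropic algebra_simps)
  hence "h y (r b3) = 0" unfolding r3 by simp
  moreover have "h y y = cj (h X (r b2)) * h y (r b1) - cj (?h b1 b2) * h y X"
    by (subst (2) y_def) simp
  hence "h y y = 0" using y by simp
  moreover have "h y p = cj b1 - cj b2" using X by (simp add: y_def)
  hence "y \<noteq> 0" using d(1) by auto
  ultimately show False using no y by blast
qed

text \<open>
  In the frame the three planes have the equations \<open>X\<^sub>3 = g b X\<^sub>0\<close>, \<open>h(X, r b) = X\<^sub>3\<close> and
  \<open>h(X, r b) = cj (g b) X\<^sub>0\<close>. If \<open>g b\<close> is not fixed by the conjugation, these force \<open>X\<^sub>0 = X\<^sub>3 = h(X, r b) = 0\<close>,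
  which describes the single point \<open>w\<close> of the proof.
\<close>

lemma perspective_imp_fixed:
  assumes "in_perspective q (vec.span {p}) (vec.span {u}) (vec.span {r b})" and b: "b \<noteq> 0"
  shows "cj (g b) = g b"
proof (rule ccontr)
  assume neq: "cj (g b) \<noteq> g b"
  let ?P = "vec.span {p}" and ?Q = "vec.span {u}" and ?R = "vec.span {r b}"
  let ?I = "vec.span (polar q ?P \<inter> polar q ?Q \<union> ?R) \<inter> vec.span (polar q ?Q \<inter> polar q ?R \<union> ?P)
     \<inter> vec.span (polar q ?R \<inter> polar q ?P \<union> ?Q)"
  have polar: "x \<in> polar q (vec.span {y}) \<longleftrightarrow> h x y = 0" for x y
    by (auto simp: polar_def span_singleton_iff intro: vec.span_base)
  have ur: "h u (r b) = cj (g b)" using herm_sym[of u "r b"] by simp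
  have sub: "vec.span T \<subseteq> {x. h x y = c * h x z}" if "T \<subseteq> {x. h x y = c * h x z}" for T c y z
    by (rule vec.span_minimal[OF that])
       (simp add: vec.subspace_def algebra_simps)
  have "polar q ?P \<inter> polar q ?Q \<union> ?R \<subseteq> {x. h x u = g b * h x p}"
    "polar q ?Q \<inter> polar q ?R \<union> ?P \<subseteq> {x. h x (r b) = 1 * h x u}"
    "polar q ?R \<inter> polar q ?P \<union> ?Q \<subseteq> {x. h x (r b) = cj (g b) * h x p}"
    by (auto simp: polar span_singleton_iff ur)
  note planes = this[THEN sub]
  have 1: "h x u = g b * h x p" if "x \<in> vec.span (polar q ?P \<inter> polar q ?Q \<union> ?R)" for x
    using planes(1) that by blast
  have 2: "h x (r b) = 1 * h x u" if "x \<in> vec.span (polar q ?Q \<inter> polar q ?R \<union> ?P)" for x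
    using planes(2) that by blast
  have 3: "h x (r b) = cj (g b) * h x p" if "x \<in> vec.span (polar q ?R \<inter> polar q ?P \<union> ?Q)" for x
    using planes(3) that by blast
  define w where "w = pt 0 (- cj (f b) / cj b) 1 0"
  have "?I \<subseteq> vec.span {w}"
  proof
    fix x assume x: "x \<in> ?I"
    note x1 = 1[of x] and x2 = 2[of x] and x3 = 3[of x]
    have "g b * h x p = h x (r b)" using x1 x2 x by simp
    also have "\<dots> = cj (g b) * h x p" using x3 x by blast
    finally have xp: "h x p = 0" using neq by simp
    hence xu: "h x u = 0" "h x (r b) = 0" using x1 x2 x by simp_all
    obtain x0 x1 x2 x3 where pt: "x = pt x0 x1 x2 x3" using pt_surj by blast
    hence "x0 = 0" "x3 = 0" "x1 * cj b + x2 * cj (f b) = 0"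
      using xp xu by (simp_all add: r_def add_eq_0_iff)
    hence "x = x2 *s w" using b by (simp add: pt w_def pt_linear pt_eq_iff field_simps eq_neg_iff_add_eq_0)
    thus "x \<in> vec.span {w}" using span_singleton_iff by blast
  qed
  hence "vec.dim ?I \<le> 1" using vec.dim_le_card[of ?I "{w}"] by simp
  thus False using assms(1) by (simp add: in_perspective_def pg_line_def)
qed

text \<open>
  A plane through \<open>p\<close> contains the three points only if their coordinates \<open>(1, f, b)\<close> modulo \<open>p\<close> are
  linearly dependent; otherwise it would contain \<open>m\<close>, then \<open>n\<close>, then \<open>u\<close>, hence everything.
\<close>

lemma coplanar_imp_affine:
  assumes "coplanar_points T" and "vec.span {p} \<in> T"
    and "vec.span {r b} \<in> T" "vec.span {r (b + s)} \<in> T" "vec.span {r (b + k * s)} \<in> T"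
    and s: "s \<noteq> 0"
  shows "f (b + k * s) = f b + k * (f (b + s) - f b)"
proof (rule ccontr)
  assume neq: "f (b + k * s) \<noteq> f b + k * (f (b + s) - f b)"
  obtain U where U: "vec.subspace U" "vec.dim U = 3" "\<And>X. X \<in> T \<Longrightarrow> X \<subseteq> U"
    using assms(1) by (auto simp: coplanar_points_def pg_plane_def)
  have in_U: "p \<in> U" "r b \<in> U" "r (b + s) \<in> U" "r (b + k * s) \<in> U"
    using U(3) assms(2-5) vec.span_base by blast+
  note cl = vec.subspace_add[OF U(1)] vec.subspace_diff[OF U(1)] vec.subspace_scale[OF U(1)]
  define D where "D = f (b + k * s) - f b - k * (f (b + s) - f b)"
  have D: "D \<noteq> 0" using neq by (simp add: D_def algebra_simps)
  define w where "w = g (b + k * s) - g b - k * (g (b + s) - g b)"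
  have "D *s m = r (b + k * s) - r b - k *s (r (b + s) - r b) - w *s p"
    by (simp add: r_def pt_def w_def D_def vec_eq_iff algebra_simps)
  hence "D *s m \<in> U" using in_U by (auto intro: cl)
  hence mU: "m \<in> U" using cl(3)[of "D *s m" "1 / D"] D by simp
  have "s *s n = r (b + s) - r b - (f (b + s) - f b) *s m - (g (b + s) - g b) *s p"
    by (simp add: r_def pt_def vec_eq_iff algebra_simps)
  hence "s *s n \<in> U" using in_U mU by (auto intro: cl)
  hence nU: "n \<in> U" using cl(3)[of "s *s n" "1 / s"] s by simp
  have "r b - f b *s m - b *s n - g b *s p \<in> U" using in_U mU nU by (intro cl)
  moreover have "r b - f b *s m - b *s n - g b *s p = u" by (simp add: r_def pt_def)
  ultimately have uU: "u \<in> U" by simp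
  have "U = UNIV"
  proof (intro equalityI subsetI)
    fix v :: "'a ^ 4"
    obtain x y z w where "v = pt x y z w" using pt_surj by blast
    thus "v \<in> U" using in_U(1) mU nU uU by (auto simp: pt_def intro: cl)
  qed simp
  thus False using U(2) vec_dim_card[where 'a='a and 'n=4] by simp
qed

text \<open>
  The point \<open>m + t p\<close> of the line is collinear with \<open>P\<close> and with the point \<open>r b\<close> for \<open>t = cj b\<close>. The Baer
  sublines through \<open>P\<close> therefore correspond to the affine lines over the subfield in the
  parameter \<open>b\<close>, and coplanarity makes \<open>f\<close> affine on each of them.
\<close>

lemma baer_condition_imp_affine:
  assumes cop: "\<And>T. baer_subline q (vec.span {p, m}) T \<Longrightarrow> vec.span {p} \<in> T \<Longrightarrow>
           coplanar_points {R\<in>S. \<exists>X\<in>T. H_collinear q X R}"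
    and s: "s \<noteq> 0" and k: "cj k = k"
  shows "f (b + k * s) = f b + k * (f (b + s) - f b)"
proof -
  let ?v = "m + cj b *s p" and ?w = "cj s *s p"
  define T where "T = {vec.span {c *s ?w + d *s ?v} | c d.
      c \<in> baer_subfield q \<and> d \<in> baer_subfield q \<and> (c, d) \<noteq> (0, 0)}"
  have bs: "c \<in> baer_subfield q \<longleftrightarrow> cj c = c" for c by (simp add: baer_subfield_def cj_def)
  have vw: "?v = pt 0 1 0 (cj b)" "?w = pt 0 0 0 (cj s)" by (simp_all add: pt_def)
  have w0: "?w \<noteq> 0" using s by (simp add: vw zero_pt pt_eq_iff)
  have nin: "?v \<notin> vec.span {?w}"
    unfolding span_singleton_iff vw pt_linear pt_eq_iff by simp
  hence ind: "vec.independent {?w, ?v}" and ne: "?w \<noteq> ?v"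
    using w0 vec.independent_insert[of ?v "{?w}"] by (auto simp: insert_commute intro: vec.span_base)
  have "vec.span {?w, ?v} = vec.span {p, m}"
  proof
    show "vec.span {?w, ?v} \<subseteq> vec.span {p, m}"
      by (rule vec.span_minimal) (auto intro!: vec.span_add vec.span_scale intro: vec.span_base)
    have wv: "?w \<in> vec.span {?w, ?v}" "?v \<in> vec.span {?w, ?v}" by (auto intro: vec.span_base)
    have pi: "p \<in> vec.span {?w, ?v}" using vec.span_scale[OF wv(1), of "1 / cj s"] s by simp
    have "m \<in> vec.span {?w, ?v}"
      using vec.span_diff[OF wv(2) vec.span_scale[OF pi, of "cj b"]] by simp
    thus "vec.span {p, m} \<subseteq> vec.span {?w, ?v}" using pi by (intro vec.span_minimal) auto
  qed
  hence T: "baer_subline q (vec.span {p, m}) T"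
    unfolding baer_subline_def T_def using ind ne by blast
  have T_mem: "vec.span {c *s ?w + d *s ?v} \<in> T" if "cj c = c" "cj d = d" "(c, d) \<noteq> (0, 0)" for c d
    unfolding T_def bs using that by blast
  have "vec.span {1 *s ?w + 0 *s ?v} \<in> T" by (rule T_mem) simp_all
  moreover have "vec.span {1 *s ?w + 0 *s ?v} = vec.span {p}"
    using span_eq_iff[OF w0, of p] by auto
  ultimately have pT: "vec.span {p} \<in> T" by simp
  have "H_collinear q (vec.span {p}) (vec.span {p})" by (simp add: H_collinear_span)
  hence "vec.span {p} \<in> {R\<in>S. \<exists>X\<in>T. H_collinear q X R}" using p_in pT by blast
  moreover have "vec.span {r (b + c * s)} \<in> {R\<in>S. \<exists>X\<in>T. H_collinear q X R}" if c: "cj c = c" for c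
  proof -
    have "vec.span {c *s ?w + 1 *s ?v} \<in> T" by (rule T_mem) (simp_all add: c)
    moreover have "h (c *s ?w + 1 *s ?v) (r (b + c * s)) = 0"
      using c herm_sym[of m "r (b + c * s)"] by (simp add: algebra_simps)
    ultimately show ?thesis using r_in H_collinear_span by blast
  qed
  from this[of 0] this[of 1] this[of k] k
  have "vec.span {r b} \<in> {R\<in>S. \<exists>X\<in>T. H_collinear q X R}"
    "vec.span {r (b + s)} \<in> {R\<in>S. \<exists>X\<in>T. H_collinear q X R}"
    "vec.span {r (b + k * s)} \<in> {R\<in>S. \<exists>X\<in>T. H_collinear q X R}" by simp_all
  ultimately show ?thesis using coplanar_imp_affine[OF cop[OF T pT] _ _ _ _ s] by blast
qed

end

context hermitian_frame
begin

text \<open>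
  The point \<open>X b\<close> of the line \<open>pm\<close> is outside the set and collinear with \<open>p\<close>, so it is collinear with
  exactly one further point of the set; that point is the one with third coordinate \<open>b\<close>.
\<close>

lemma special_graph_exists:
  assumes S: "special_set q S" and P: "vec.span {p} \<in> S"
  shows "\<exists>f g. special_graph q p u m n S f g"
proof -
  define X where "X b = pt 0 1 0 (cj b)" for b
  have X: "X b \<noteq> 0" "h (X b) (X b) = 0" "h (X b) p = 0" "h p (X b) = 0" for b
    using herm_sym[of p "X b"] by (simp_all add: X_def zero_pt pt_eq_iff)
  have hX: "h (X b) (pt 1 a b' c) = cj b - cj b'" for a b b' c by (simp add: X_def)
  have nX: "vec.span {X b} \<notin> S" for b
  proof
    assume XS: "vec.span {X b} \<in> S"
    have "vec.span {X b} \<noteq> vec.span {p}"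
    proof
      assume "vec.span {X b} = vec.span {p}"
      then obtain c where "X b = c *s p" using span_eq_iff[OF X(1)] by blast
      hence "pt 0 1 0 (cj b) = pt 0 0 0 c" by (simp add: X_def pt_def)
      thus False by (simp add: pt_eq_iff)
    qed
    from special_noncollinear[OF S XS P this] show False using X(3) by simp
  qed
  have normalise: "\<exists>a b c. R = vec.span {pt 1 a b c}" if R: "R \<in> S" "R \<noteq> vec.span {p}" for R
  proof -
    obtain x where x: "x \<noteq> 0" "R = vec.span {x}" using special_cases[OF S R(1)] by blast
    obtain x0 x1 x2 x3 where pt: "x = pt x0 x1 x2 x3" using pt_surj by blast
    have "h x p \<noteq> 0" using special_noncollinear[OF S _ P, of x] R x(2) by blast
    hence "x0 \<noteq> 0" by (simp add: pt)
    hence "x = x0 *s pt 1 (x1 / x0) (x2 / x0) (x3 / x0)" by (simp add: pt pt_linear)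
    thus ?thesis using span_eq_iff[OF x(1)] x(2) by blast
  qed
  have np: "vec.span {pt 1 a b c} \<noteq> vec.span {p}" for a b c
  proof
    assume eq: "vec.span {pt 1 a b c} = vec.span {p}"
    have "pt 1 a b c \<noteq> 0" by (simp add: zero_pt pt_eq_iff)
    then obtain k where "pt 1 a b c = k *s p" using span_eq_iff eq by blast
    hence "pt 1 a b c = pt 0 0 0 k" by (simp add: pt_def)
    thus False by (simp add: pt_eq_iff)
  qed
  have "\<exists>a c. vec.span {pt 1 a b c} \<in> S" for b
  proof -
    define N where "N = {R\<in>S. H_collinear q (vec.span {X b}) R}"
    have PN: "vec.span {p} \<in> N" using P X(3) by (simp add: N_def H_collinear_span)
    have fin: "finite N" using S by (simp add: N_def special_set_def)
    have "card N \<in> {0, 2}" unfolding N_def by (rule special_count[OF S X(1,2) nX])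
    hence "card N = 2" using PN fin by auto
    hence "N \<noteq> {vec.span {p}}" by auto
    then obtain R where R: "R \<in> S" "H_collinear q (vec.span {X b}) R" "R \<noteq> vec.span {p}"
      using PN unfolding N_def by blast
    obtain a b' c where abc: "R = vec.span {pt 1 a b' c}" using normalise[OF R(1,3)] by blast
    have "cj b - cj b' = 0" using R(2) unfolding abc H_collinear_span hX .
    hence "b' = b" by simp
    thus ?thesis using R(1) abc by blast
  qed
  then obtain f g where fg: "\<And>b. vec.span {pt 1 (f b) b (g b)} \<in> S" by metis
  have "S = insert (vec.span {p}) (range (\<lambda>b. vec.span {pt 1 (f b) b (g b)}))"
  proof (intro equalityI subsetI)
    fix R assume R: "R \<in> S"
    show "R \<in> insert (vec.span {p}) (range (\<lambda>b. vec.span {pt 1 (f b) b (g b)}))"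
    proof (cases "R = vec.span {p}")
      case False
      then obtain a b c where abc: "R = vec.span {pt 1 a b c}" using normalise[OF R] by blast
      have "h (X b) (pt 1 a b c) = 0" "h (X b) (pt 1 (f b) b (g b)) = 0" by (simp_all only: hX) simp_all
      from special_third[OF S X(1,2) nX refl P X(3) refl fg this(2) np[symmetric] abc R this(1)]
      have "R = vec.span {pt 1 (f b) b (g b)}" using False by blast
      thus ?thesis by blast
    qed simp
  qed (use fg P in auto)
  hence "special_graph q p u m n S f g" by unfold_locales (rule S)
  thus ?thesis by blast
qed

end

section \<open>Quadratic forms over the subfield\<close>

context hermitian_field
begin

text \<open>
  The three functions below describe \<open>f\<close>, \<open>g\<close> and the form between two points of the graph once both
  hypotheses have been used: \<open>f\<close> is linear over the subfield, \<open>g\<close> is the quadratic form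
  over the subfield that makes the points isotropic, and \<open>frob_pairing\<close> is \<open>h (r b) (r b')\<close>.
\<close>

definition frob_linear :: "'a \<Rightarrow> 'a \<Rightarrow> 'a \<Rightarrow> 'a" where
  "frob_linear A B b = A * b + B * cj b"

definition frob_form :: "'a \<Rightarrow> 'a \<Rightarrow> 'a \<Rightarrow> 'a" where
  "frob_form A B b = (frob_linear A B b * cj b + cj (frob_linear A B b) * b) / 2"

definition frob_pairing :: "'a \<Rightarrow> 'a \<Rightarrow> 'a \<Rightarrow> 'a \<Rightarrow> 'a" where
  "frob_pairing A B b b' = frob_form A B b + frob_form A B b' - frob_linear A B b * cj b' - b * cj (frob_linear A B b')"

text \<open>
  The first summand lies in the subfield and the second has trace zero, because \<open>A + cj A\<close> lies in the
  subfield and \<open>b * cj b' - cj b * b'\<close> has trace zero.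
\<close>

lemma frob_pairing_eq:
  "frob_pairing A B b b' = frob_form A B (b - b') - (A + cj A) / 2 * (b * cj b' - cj b * b')"
  by (simp add: frob_pairing_def frob_form_def frob_linear_def field_simps)

text \<open>
  A map that is linear over the subfield is determined by its values at 1 and at an element \<open>e\<close> of
  trace zero, and \<open>A\<close>, \<open>B\<close> are found from these two values.
\<close>

lemma additive_homogeneous_eq_frob_linear:
  assumes add: "\<And>x y. f (x + y) = f x + f y"
    and hom: "\<And>k x. cj k = k \<Longrightarrow> f (k * x) = k * f x"
  shows "\<exists>A B. \<forall>b. f b = frob_linear A B b"
proof -
  obtain e where e: "e \<noteq> 0" "cj e = - e" using skew_exists by blast
  have "f b = frob_linear ((f 1 + f e / e) / 2) ((f 1 - f e / e) / 2) b" for b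
  proof -
    let ?m = "(b + cj b) / 2" and ?n = "(b - cj b) / (2 * e)"
    have F: "cj ?m = ?m" "cj ?n = ?n" using e by (simp_all add: field_simps)
    have "b = ?m * 1 + ?n * e" using e by (simp add: field_simps)
    hence "f b = f (?m * 1 + ?n * e)" by simp
    also have "\<dots> = ?m * f 1 + ?n * f e" by (simp only: add hom[OF F(1)] hom[OF F(2)])
    also have "\<dots> = frob_linear ((f 1 + f e / e) / 2) ((f 1 - f e / e) / 2) b"
      using e by (simp add: frob_linear_def field_simps)
    finally show ?thesis .
  qed
  thus ?thesis by blast
qed

text \<open>
  An anisotropic binary form over the subfield is a multiple of the norm form \<open>(m + t n)(m - t n)\<close> with
  \<open>t\<^sup>2 = - r / s\<close>, where \<open>t\<close> has trace zero; the norm is surjective onto the subfield.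
\<close>

lemma anisotropic_represents:
  assumes F: "cj r = r" "cj s = s" "cj K = K" and "s \<noteq> 0" "r \<noteq> 0"
    and aniso: "\<And>m. cj m = m \<Longrightarrow> s * m\<^sup>2 + r \<noteq> 0"
  shows "\<exists>m n. cj m = m \<and> cj n = n \<and> s * m\<^sup>2 + r * n\<^sup>2 = K"
proof -
  obtain t where t: "t\<^sup>2 = - r / s" using sqrt_exists[of "- r / s"] F by auto
  have "(cj t)\<^sup>2 = cj (t\<^sup>2)" by simp
  also have "\<dots> = t\<^sup>2" unfolding t by (simp add: F)
  finally have "cj t = t \<or> cj t = - t" by (simp add: power2_eq_iff)
  moreover have "cj t \<noteq> t" using aniso[of t] t \<open>s \<noteq> 0\<close> by auto
  ultimately have t': "cj t = - t" by blast
  have t0: "t \<noteq> 0" using t \<open>r \<noteq> 0\<close> \<open>s \<noteq> 0\<close> by auto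
  obtain z where z: "z * cj z = K / s" using norm_surj[of "K / s"] F by auto
  let ?m = "(z + cj z) / 2" and ?n = "(z - cj z) / (2 * t)"
  have "z = ?m + t * ?n" "cj z = ?m - t * ?n" using t0 by (simp_all add: field_simps)
  hence "z * cj z = (?m + t * ?n) * (?m - t * ?n)" by simp
  also have "\<dots> = ?m\<^sup>2 - t\<^sup>2 * ?n\<^sup>2" by (simp add: algebra_simps power2_eq_square)
  finally have "z * cj z = ?m\<^sup>2 - t\<^sup>2 * ?n\<^sup>2" .
  hence eq: "?m\<^sup>2 - t\<^sup>2 * ?n\<^sup>2 = K / s" using z by simp
  have "s * ?m\<^sup>2 + r * ?n\<^sup>2 = s * (?m\<^sup>2 - t\<^sup>2 * ?n\<^sup>2)"
    unfolding t right_diff_distrib using \<open>s \<noteq> 0\<close> by simp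
  hence "s * ?m\<^sup>2 + r * ?n\<^sup>2 = K" unfolding eq using \<open>s \<noteq> 0\<close> by simp
  moreover have "cj ?m = ?m" "cj ?n = ?n" using t' t0 by (simp_all add: field_simps)
  ultimately show ?thesis by blast
qed

text \<open>
  The products of the form around the triangle of the next lemma, as a polynomial identity. Only the
  terms of even degree in \<open>g\<close> survive in the sum of the two conjugate products.
\<close>

lemma triple_identity:
  fixes r s g m n :: 'a
  assumes "g\<^sup>2 * (s * m\<^sup>2 + r * n\<^sup>2) = (r + s) * (g\<^sup>2 / 4 + r * s)"
  shows "((r + s) - g * (m + n)) * (r + g * (m - 1/2)) * (s + g * (n - 1/2))
       + ((r + s) + g * (m + n)) * (r - g * (m - 1/2)) * (s - g * (n - 1/2)) = 0"
proof -
  define \<kappa> where "\<kappa> = (1/2 :: 'a)"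
  have \<kappa>: "1/4 = \<kappa>\<^sup>2" by (simp add: \<kappa>_def power2_eq_square)
  have "((r + s) - g * (m + n)) * (r + g * (m - \<kappa>)) * (s + g * (n - \<kappa>))
       + ((r + s) + g * (m + n)) * (r - g * (m - \<kappa>)) * (s - g * (n - \<kappa>))
     = 2 * ((r + s) * (g\<^sup>2 * \<kappa>\<^sup>2 + r * s) - g\<^sup>2 * (s * m\<^sup>2 + r * n\<^sup>2))"
    by (simp add: algebra_simps power2_eq_square)
  also have "\<dots> = 0" unfolding assms \<kappa>[symmetric] by simp
  finally show ?thesis by (simp add: \<kappa>_def)
qed

text \<open>
  Let \<open>c = frob_form A B\<close> and \<open>\<alpha> = A + cj A\<close>. For \<open>\<alpha> \<noteq> 0\<close> a triangle \<open>b1, b2, b3\<close> is constructed for which the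
  product of the form around the triangle has trace zero. In a basis \<open>1, y\<close> over the
  subfield that is orthogonal for \<open>c\<close>, the triangles with sides \<open>1\<close>, \<open>y\<close>, \<open>1 - y\<close> are parametrised by their
  translation \<open>(m, n)\<close>, and trace zero becomes the equation \<open>s m\<^sup>2 + r n\<^sup>2 = K\<close> of a conic with \<open>s = c(1)\<close>
  and \<open>r = c(y)\<close>. As \<open>c\<close> is anisotropic, this equation has a solution for every \<open>K\<close> in the subfield.
\<close>

lemma skew_if_special:
  assumes aniso: "\<And>b. b \<noteq> 0 \<Longrightarrow> frob_form A B b \<noteq> 0"
    and triple: "\<And>b1 b2 b3. b1 \<noteq> b2 \<Longrightarrow> b2 \<noteq> b3 \<Longrightarrow> b3 \<noteq> b1 \<Longrightarrow>
      frob_pairing A B b1 b2 * frob_pairing A B b2 b3 * frob_pairing A B b3 b1 + frob_pairing A B b2 b1 * frob_pairing A B b3 b2 * frob_pairing A B b1 b3 \<noteq> 0"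
  shows "A + cj A = 0"
proof (rule ccontr)
  define \<alpha> where "\<alpha> = A + cj A"
  assume "A + cj A \<noteq> 0"
  hence \<alpha>0: "\<alpha> \<noteq> 0" by (simp add: \<alpha>_def)
  have \<alpha>: "cj \<alpha> = \<alpha>" by (simp add: \<alpha>_def)
  have frob_form: "frob_form A B b = (\<alpha> * b * cj b + cj B * b\<^sup>2 + B * (cj b)\<^sup>2) / 2" for b
    by (simp add: frob_form_def frob_linear_def \<alpha>_def field_simps power2_eq_square)
  have qf_F: "cj (frob_form A B b) = frob_form A B b" for b by (simp add: frob_form_def field_simps)
  define d where "d = \<alpha> + 2 * cj B"
  have "d + cj d = 4 * frob_form A B 1" by (simp add: frob_form d_def \<alpha> field_simps)
  hence d0: "d \<noteq> 0" using aniso[of 1] by auto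
  obtain e where e: "e \<noteq> 0" "cj e = - e" using skew_exists by blast
  \<comment> \<open>The form c is diagonal in the basis 1, y over the subfield.\<close>
  define y where "y = e / d"
  have y0: "y \<noteq> 0" using e d0 by (simp add: y_def)
  define s r where "s = frob_form A B 1" and "r = frob_form A B y"
  have orth: "frob_form A B (m + n * y) = s * m\<^sup>2 + r * n\<^sup>2" if "cj m = m" "cj n = n" for m n
  proof -
    have "d * y + cj (d * y) = 0" using d0 e by (simp add: y_def)
    hence o: "\<alpha> * y + \<alpha> * cj y + 2 * cj B * y + 2 * B * cj y = 0"
      by (simp add: d_def \<alpha> algebra_simps)
    have "2 * frob_form A B (m + n * y) = 2 * (s * m\<^sup>2 + r * n\<^sup>2)
        + m * n * (\<alpha> * y + \<alpha> * cj y + 2 * cj B * y + 2 * B * cj y)"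
      unfolding s_def r_def frob_form by (simp add: that) (simp add: algebra_simps power2_eq_square)
    hence "2 * frob_form A B (m + n * y) = 2 * (s * m\<^sup>2 + r * n\<^sup>2)" unfolding o by simp
    thus ?thesis by (simp only: mult_cancel_left two_neq_0) simp
  qed
  have s0: "s \<noteq> 0" and r0: "r \<noteq> 0" using aniso y0 by (auto simp: s_def r_def)
  have y_F: "cj y \<noteq> y"
  proof
    assume "cj y = y"
    hence "s * y\<^sup>2 + r = 0" "s * y\<^sup>2 = r"
      using orth[of "- y" 1] orth[of y 0] by (simp_all add: frob_form r_def)
    thus False using r0 by simp
  qed
  define W where "W = cj y - y"
  define \<beta> where "\<beta> = \<alpha> / 2"
  define g where "g = \<beta> * W"
  have g0: "g \<noteq> 0" using y_F \<alpha>0 by (simp add: g_def W_def \<beta>_def)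
  have g2: "cj (g\<^sup>2) = g\<^sup>2" by (simp add: g_def \<beta>_def W_def \<alpha> power_mult_distrib power_divide power2_commute)
  have rs_F: "cj r = r" "cj s = s" by (simp_all add: r_def s_def qf_F)
  \<comment> \<open>The right-hand side is the value for which the triple product below has trace zero.\<close>
  have "\<exists>m n. cj m = m \<and> cj n = n \<and> s * m\<^sup>2 + r * n\<^sup>2 = (r + s) * (g\<^sup>2 / 4 + r * s) / g\<^sup>2"
  proof (rule anisotropic_represents[OF rs_F _ s0 r0])
    show "cj ((r + s) * (g\<^sup>2 / 4 + r * s) / g\<^sup>2) = (r + s) * (g\<^sup>2 / 4 + r * s) / g\<^sup>2"
      using g2 by (simp add: rs_F)
    fix m assume m: "cj m = m"
    hence "m + y \<noteq> 0" using y_F by (metis add_eq_0_iff cj_minus)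
    thus "s * m\<^sup>2 + r \<noteq> 0" using aniso[of "m + y"] orth[of m 1] m by simp
  qed
  then obtain m n where mn: "cj m = m" "cj n = n"
    and "s * m\<^sup>2 + r * n\<^sup>2 = (r + s) * (g\<^sup>2 / 4 + r * s) / g\<^sup>2" by blast
  hence eq: "g\<^sup>2 * (s * m\<^sup>2 + r * n\<^sup>2) = (r + s) * (g\<^sup>2 / 4 + r * s)" using g0 by simp
  define \<kappa> where "\<kappa> = (1/2 :: 'a)"
  have hh: "\<kappa> + \<kappa> = 1" and \<kappa>: "cj \<kappa> = \<kappa>" by (simp_all add: \<kappa>_def)
  \<comment> \<open>A triangle with sides 1, y and 1 - y; the parameters m and n translate it.\<close>
  define b1 b2 b3 where "b1 = (m + \<kappa>) + (n - \<kappa>) * y"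
    and "b2 = (m - \<kappa>) + (n + \<kappa>) * y" and "b3 = (m - \<kappa>) + (n - \<kappa>) * y"
  have "b1 - b2 = (\<kappa> + \<kappa>) + (- (\<kappa> + \<kappa>)) * y" "b2 - b3 = 0 + (\<kappa> + \<kappa>) * y"
    "b3 - b1 = - (\<kappa> + \<kappa>) + 0 * y" "b2 - b1 = - (\<kappa> + \<kappa>) + (\<kappa> + \<kappa>) * y"
    "b3 - b2 = 0 + (- (\<kappa> + \<kappa>)) * y" "b1 - b3 = (\<kappa> + \<kappa>) + 0 * y"
    by (simp_all add: b1_def b2_def b3_def algebra_simps)
  note diffs = this[unfolded hh]
  have det: "(k + l * y) * (k' + l' * cj y) - (k + l * cj y) * (k' + l' * y)
      = (k * l' - l * k') * W" for k l k' l'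
    by (simp add: W_def algebra_simps)
  have "b1 * cj b2 - cj b1 * b2 = (\<kappa> + \<kappa>) * (m + n) * W"
    "b2 * cj b3 - cj b2 * b3 = - (\<kappa> + \<kappa>) * (m - \<kappa>) * W"
    "b3 * cj b1 - cj b3 * b1 = - (\<kappa> + \<kappa>) * (n - \<kappa>) * W"
    unfolding b1_def b2_def b3_def cj_add cj_diff cj_mult mn \<kappa> det by (simp_all add: algebra_simps)
  note br = this[unfolded hh mult_1 mult_minus_left]
  have qd: "frob_form A B (b1 - b2) = r + s" "frob_form A B (b2 - b3) = r" "frob_form A B (b3 - b1) = s"
    "frob_form A B (b2 - b1) = r + s" "frob_form A B (b3 - b2) = r" "frob_form A B (b1 - b3) = s"
    unfolding diffs by (subst orth; simp)+
  have H: "frob_pairing A B b1 b2 = (r + s) - g * (m + n)" "frob_pairing A B b2 b3 = r + g * (m - \<kappa>)"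
    "frob_pairing A B b3 b1 = s + g * (n - \<kappa>)"
    unfolding frob_pairing_eq qd br \<alpha>_def[symmetric] \<beta>_def[symmetric] g_def by (simp_all add: algebra_simps)
  have "b2 * cj b1 - cj b2 * b1 = - ((m + n) * W)"
    "b3 * cj b2 - cj b3 * b2 = - (- ((m - \<kappa>) * W))"
    "b1 * cj b3 - cj b1 * b3 = - (- ((n - \<kappa>) * W))"
    unfolding br[symmetric] by simp_all
  note br' = this
  have H': "frob_pairing A B b2 b1 = (r + s) + g * (m + n)" "frob_pairing A B b3 b2 = r - g * (m - \<kappa>)"
    "frob_pairing A B b1 b3 = s - g * (n - \<kappa>)"
    unfolding frob_pairing_eq qd br' \<alpha>_def[symmetric] \<beta>_def[symmetric] g_def by (simp_all add: algebra_simps)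
  have "y \<noteq> 1" using y_F by auto
  hence "b1 - b2 \<noteq> 0" "b2 - b3 \<noteq> 0" "b3 - b1 \<noteq> 0"
    unfolding diffs using y0 by simp_all
  hence "b1 \<noteq> b2" "b2 \<noteq> b3" "b3 \<noteq> b1" by simp_all
  from triple[OF this] triple_identity[OF eq] show False unfolding H H' \<kappa>_def by simp
qed

text \<open>
  A square root \<open>t\<close> of \<open>- B cj B\<close> exists in the field and is fixed or negated by the conjugation. If it is
  negated, then \<open>t / cj B\<close> has norm 1, hence has the form \<open>cj y / y\<close>, and \<open>cj y\<close> is a nontrivial zero of
  the anisotropic form.
\<close>

lemma minus_norm_is_square:
  assumes aniso: "\<And>b. b \<noteq> 0 \<Longrightarrow> cj B * b\<^sup>2 + B * (cj b)\<^sup>2 \<noteq> 0"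
  shows "\<exists>\<eta>. \<eta> \<noteq> 0 \<and> cj \<eta> = \<eta> \<and> \<eta>\<^sup>2 = - (B * cj B)"
proof -
  have B0: "B \<noteq> 0" using aniso[of 1] by auto
  obtain t where t: "t\<^sup>2 = - (B * cj B)" using sqrt_exists[of "- (B * cj B)"] by (auto simp: mult.commute)
  have t0: "t \<noteq> 0" using t B0 by auto
  have "(cj t)\<^sup>2 = cj (t\<^sup>2)" by simp
  also have "\<dots> = t\<^sup>2" unfolding t by (simp add: mult.commute)
  finally have "cj t = t \<or> cj t = - t" by (simp add: power2_eq_iff)
  moreover have "cj t \<noteq> - t"
  proof
    assume neg: "cj t = - t"
    define g where "g = t / cj B"
    have g: "g * cj g = 1" using t neg B0 by (simp add: g_def field_simps power2_eq_square)
    obtain y where y: "y \<noteq> 0" "cj y = g * y"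
    proof (cases "g = - 1")
      case True
      thus ?thesis using skew_exists that by auto
    next
      case False
      hence "1 + cj g \<noteq> 0" by (metis add_eq_0_iff cj_1 cj_cj cj_minus)
      moreover have "cj (1 + cj g) = g * (1 + cj g)" using g by (simp add: algebra_simps)
      ultimately show ?thesis using that by blast
    qed
    have "cj B * (cj y)\<^sup>2 = t * (y * cj y)"
      using B0 y(2) by (simp add: g_def power2_eq_square)
    moreover from arg_cong[OF this, of cj] have "B * y\<^sup>2 = - t * (y * cj y)"
      by (simp add: neg mult_ac)
    ultimately show False using aniso[of "cj y"] y(1) by simp
  qed
  ultimately show ?thesis using t t0 by blast
qed

end

section \<open>Equivalence with the Hermitian Veronesean\<close>

context hermitian_field
begin

text \<open>
  A similarity of a nondegenerate form is injective, hence bijective on a finite space; its inverse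
  is again a similarity and preserves isotropy.
\<close>

lemma similarity_in_PGammaU:
  fixes G :: "'a ^ 4 \<Rightarrow> 'a ^ 4"
  assumes add: "\<And>x y. G (x + y) = G x + G y" and scale: "\<And>c x. G (c *s x) = c *s G x"
    and sim: "\<And>x y. h (G x) (G y) = k * h x y" and k: "k \<noteq> 0"
  shows "\<exists>\<phi>\<in>PGammaU q. \<forall>x. \<phi> (vec.span {G x}) = vec.span {x}"
proof -
  have inj: "inj G"
  proof (rule injI)
    fix x y assume eq: "G x = G y"
    have "G x = G (x - y) + G y" using add[of "x - y" y] by simp
    hence "G (x - y) = 0" using eq by simp
    hence "h (x - y) z = 0" for z using sim[of "x - y" z] k by simp
    from herm_nondegenerate[OF this] show "x = y" by simp
  qed
  hence surj: "surj G" by (simp add: finite_UNIV_inj_surj)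
  define F where "F = inv G"
  have FG: "F (G x) = x" for x using inj by (simp add: F_def)
  have GF: "G (F x) = x" for x using surj by (simp add: F_def surj_f_inv_f)
  have F_add: "F (x + y) = F x + F y" for x y
    using FG[of "F x + F y"] by (simp add: add GF)
  have F_scale: "F (c *s x) = c *s F x" for c x
    using FG[of "c *s F x"] by (simp add: scale GF)
  have F_span: "F ` vec.span {x} = vec.span {F x}" for x
    by (auto simp: vec.span_singleton F_scale image_iff)
  have F_h: "h (F x) (F x) = 0 \<longleftrightarrow> h x x = 0" for x
    using sim[of "F x" "F x"] k by (simp add: GF)
  have F_0: "F x = 0 \<longleftrightarrow> x = 0" for x
    using F_scale[of 0 0] GF[of x] scale[of 0 0] by auto
  have "bij F" unfolding bij_def using FG GF
    by (metis injI surjI)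
  moreover have "field_automorphism (id :: 'a \<Rightarrow> 'a)"
    by (simp add: field_automorphism_def)
  hence "\<exists>\<sigma>. field_automorphism \<sigma> \<and> (\<forall>c x. F (c *s x) = \<sigma> c *s F x)"
    using F_scale by (intro exI[of _ id]) simp
  ultimately have "semilinear_bijection F" using F_add by (simp add: semilinear_bijection_def)
  moreover have "(`) F ` hermitian_surface q = hermitian_surface q"
  proof (intro equalityI subsetI)
    fix Y :: "'a subsp" assume "Y \<in> (`) F ` hermitian_surface q"
    then obtain X where "X \<in> hermitian_surface q" "Y = F ` X" by blast
    thus "Y \<in> hermitian_surface q"
      by (metis F_span F_h F_0 surface_cases span_in_surface_iff)
  next
    fix Y :: "'a subsp" assume "Y \<in> hermitian_surface q"
    then obtain y where y: "y \<noteq> 0" "h y y = 0" "Y = vec.span {y}" by (rule surface_cases)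
    have "Y = F ` vec.span {G y}" by (simp add: F_span FG y)
    moreover have "vec.span {G y} \<in> hermitian_surface q"
      using y F_h[of "G y"] F_0[of "G y"] by (simp add: FG span_in_surface_iff)
    ultimately show "Y \<in> (`) F ` hermitian_surface q" by blast
  qed
  ultimately have "(`) F \<in> PGammaU q" unfolding PGammaU_def by blast
  moreover have "\<forall>x. F ` vec.span {G x} = vec.span {x}" by (simp add: F_span FG)
  ultimately show ?thesis by blast
qed

end

context hermitian_frame
begin

text \<open>
  Put \<open>M = cj B / \<eta>\<close>, an element of norm \<open>- 1\<close>, and \<open>\<xi> b = M * b + cj b\<close>. Then \<open>\<xi> b * cj (\<xi> b)\<close> is \<open>2 / \<eta>\<close> times
  \<open>frob_form A B b\<close>, and so the map that sends the vector with parameter \<open>b\<close> to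
  \<open>(1, \<xi> b, cj (\<xi> b), \<xi> b * cj (\<xi> b))\<close> extends linearly; the extension multiplies the form by \<open>2 / \<eta>\<close>, and its inverse \<open>G\<close> is written down explicitly.
\<close>

lemma normal_form_equivalent:
  assumes A: "A + cj A = 0" and \<eta>: "\<eta> \<noteq> 0" "cj \<eta> = \<eta>" "\<eta>\<^sup>2 = - (B * cj B)"
  shows "\<exists>\<phi>\<in>PGammaU q.
    \<phi> ` insert (vec.span {p}) (range (\<lambda>b. vec.span {pt 1 (frob_linear A B b) b (frob_form A B b)}))
      = hermitian_veronesean q"
proof -
  define M where "M = cj B / \<eta>"
  define h2 where "h2 = (1/2 :: 'a)"
  have h2: "cj h2 = h2" "h2 + h2 = 1" by (simp_all add: h2_def)
  have cA: "cj A = - A" using A by (simp add: add_eq_0_iff)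
  have cM: "cj M = B / \<eta>" by (simp add: M_def \<eta>)
  have B0: "B \<noteq> 0" using \<eta> by auto
  have BM: "B * M = - \<eta>" "cj B * cj M = - \<eta>"
    using \<eta> B0 by (simp_all add: M_def cM field_simps power2_eq_square)
  have MM: "M * cj M = - 1" using \<eta> B0 by (simp add: M_def cM field_simps power2_eq_square)
  have BM': "cj B * cj M * cj M = - B" "B * M * M = - cj B"
    unfolding BM using \<eta>(1) by (simp_all add: M_def \<eta>(2))
  \<comment> \<open>The functions s and t solve v $ 2 = t / B + M * s and v $ 3 = cj M * t / B + s.\<close>
  define s where "s v = h2 * (v $ 3 - cj M * v $ 2)" for v :: "'a ^ 4"
  define t where "t v = h2 * B * (v $ 2 - M * v $ 3)" for v :: "'a ^ 4"
  define G where "G v = pt (v $ 1) (t v + A * s v) (s v) (h2 * \<eta> * v $ 4)" for v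
  have G_add: "G (x + y) = G x + G y" for x y
    by (simp add: G_def s_def t_def pt_linear pt_eq_iff algebra_simps)
  have G_scale: "G (c *s x) = c *s G x" for c x
    by (simp add: G_def s_def t_def pt_linear pt_eq_iff algebra_simps)
  have st: "t x * cj (s y) + s x * cj (t y)
      = h2 * \<eta> * (x $ 2 * cj (y $ 2) + x $ 3 * cj (y $ 3))" for x y
  proof -
    have "t x * cj (s y) + s x * cj (t y) = h2 * h2 *
       (- (B * M + cj B * cj M) * (x $ 2 * cj (y $ 2) + x $ 3 * cj (y $ 3))
        + (B + cj B * cj M * cj M) * (x $ 2 * cj (y $ 3))
        + (cj B + B * M * M) * (x $ 3 * cj (y $ 2)))"
      by (simp add: s_def t_def h2 algebra_simps)
    also have "\<dots> = (h2 + h2) * h2 * \<eta> * (x $ 2 * cj (y $ 2) + x $ 3 * cj (y $ 3))"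
      unfolding BM' unfolding BM by (simp add: algebra_simps)
    finally show ?thesis unfolding h2 by simp
  qed
  have G_sim: "h (G x) (G y) = h2 * \<eta> * h x y" for x y
  proof -
    have "h (G x) (G y) = h2 * \<eta> * (x $ 1 * cj (y $ 4) + x $ 4 * cj (y $ 1))
       - (t x * cj (s y) + s x * cj (t y))"
      by (simp add: G_def h2 \<eta> cA algebra_simps)
    thus ?thesis unfolding st by (simp add: herm_cj algebra_simps)
  qed
  have "h2 * \<eta> \<noteq> 0" using \<eta> by (simp add: h2_def)
  from similarity_in_PGammaU[OF G_add G_scale G_sim this]
  obtain \<phi> where \<phi>: "\<phi> \<in> PGammaU q" "\<And>x. \<phi> (vec.span {G x}) = vec.span {x}" by blast
  define V where "V x = (vector [1, x, x ^ q, x ^ (q + 1)] :: 'a ^ 4)" for x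
  define \<xi> where "\<xi> b = M * b + cj b" for b
  have G_V: "G (V (\<xi> b)) = pt 1 (frob_linear A B b) b (frob_form A B b)" for b
  proof -
    have V: "V (\<xi> b) $ 1 = 1" "V (\<xi> b) $ 2 = M * b + cj b" "V (\<xi> b) $ 3 = cj M * cj b + b"
      "V (\<xi> b) $ 4 = (M * b + cj b) * (cj M * cj b + b)"
      by (simp_all add: V_def vector_4 \<xi>_def flip: cj_def)
    have "s (V (\<xi> b)) = h2 * (b - M * cj M * b)" unfolding s_def V by (simp add: algebra_simps)
    also have "\<dots> = (h2 + h2) * b" unfolding MM by (simp add: algebra_simps)
    finally have s: "s (V (\<xi> b)) = b" unfolding h2 by simp
    have "t (V (\<xi> b)) = h2 * B * (cj b - M * cj M * cj b)" unfolding t_def V by (simp add: algebra_simps)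
    also have "\<dots> = (h2 + h2) * B * cj b" unfolding MM by (simp add: algebra_simps)
    finally have t: "t (V (\<xi> b)) = B * cj b" unfolding h2 by simp
    have "h2 * \<eta> * V (\<xi> b) $ 4 = h2 * ((\<eta> * M) * b\<^sup>2 + (\<eta> * cj M) * (cj b)\<^sup>2
        + \<eta> * (b * cj b) * (1 + M * cj M))"
      unfolding V by (simp add: algebra_simps power2_eq_square)
    also have "\<dots> = h2 * (cj B * b\<^sup>2 + B * (cj b)\<^sup>2)"
      unfolding MM using \<eta>(1) by (simp add: M_def \<eta>)
    also have "\<dots> = frob_form A B b"
      by (simp add: h2_def frob_form_def frob_linear_def cA algebra_simps power2_eq_square)
    finally show ?thesis unfolding G_def s t by (simp add: V frob_linear_def algebra_simps)
  qed
  have "inj \<xi>"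
  proof (rule injI)
    fix b b' assume "\<xi> b = \<xi> b'"
    hence "G (V (\<xi> b)) = G (V (\<xi> b'))" by simp
    thus "b = b'" unfolding G_V pt_eq_iff by blast
  qed
  hence surj: "surj \<xi>" by (simp add: finite_UNIV_inj_surj)
  have p0: "p \<noteq> 0"
  proof
    assume "p = 0"
    from arg_cong[OF this, of "\<lambda>x. h x u"] show False by simp
  qed
  have "G (vector [0, 0, 0, 1]) = (h2 * \<eta>) *s p"
    by (simp add: G_def s_def t_def vector_4 pt_def)
  hence "vec.span {G (vector [0, 0, 0, 1])} = vec.span {p}"
    using span_eq_iff[of "(h2 * \<eta>) *s p" p] \<open>h2 * \<eta> \<noteq> 0\<close> p0 by auto
  hence "\<phi> (vec.span {p}) = vec.span {vector [0, 0, 0, 1]}" using \<phi>(2) by metis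
  moreover have "\<phi> (vec.span {pt 1 (frob_linear A B b) b (frob_form A B b)}) = vec.span {V (\<xi> b)}" for b
    using \<phi>(2)[of "V (\<xi> b)"] unfolding G_V .
  ultimately have "\<phi> ` insert (vec.span {p}) (range (\<lambda>b. vec.span {pt 1 (frob_linear A B b) b (frob_form A B b)}))
      = insert (vec.span {vector [0, 0, 0, 1]}) ((\<lambda>x. vec.span {V x}) ` range \<xi>)"
    by (simp add: image_image)
  also have "\<dots> = hermitian_veronesean q"
    unfolding surj hermitian_veronesean_def V_def by simp
  finally show ?thesis using \<phi>(1) by blast
qed

end

context special_graph
begin

text \<open>
  The Baer subline condition makes \<open>f\<close> linear over the subfield and the perspectivity condition makes \<open>g\<close> the
  form \<open>frob_form A B\<close>, since \<open>r b\<close> is isotropic and \<open>g b\<close> is in the subfield. Pairing \<open>r b\<close> with \<open>Q = r 0\<close>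
  shows that this form is anisotropic, and the triples of points leave only the normal form.
\<close>

lemma special_graph_equivalent:
  assumes Q: "vec.span {u} \<in> S"
    and cop: "\<And>T. baer_subline q (vec.span {p, m}) T \<Longrightarrow> vec.span {p} \<in> T \<Longrightarrow>
           coplanar_points {R\<in>S. \<exists>X\<in>T. H_collinear q X R}"
    and persp: "\<And>R. R \<in> S \<Longrightarrow> R \<noteq> vec.span {p} \<Longrightarrow> R \<noteq> vec.span {u} \<Longrightarrow>
           in_perspective q (vec.span {p}) (vec.span {u}) R"
  shows "\<exists>\<phi>\<in>PGammaU q. \<phi> ` S = hermitian_veronesean q"
proof -
  have "u \<noteq> 0"
  proof
    assume "u = 0"
    from arg_cong[OF this, of "\<lambda>x. h x p"] show False by simp
  qed
  have "vec.span {u} \<noteq> vec.span {p}"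
  proof
    assume "vec.span {u} = vec.span {p}"
    then obtain c where "u = c *s p" using span_eq_iff[OF \<open>u \<noteq> 0\<close>] by blast
    from arg_cong[OF this, of "\<lambda>x. h x p"] show False by simp
  qed
  then obtain b where "vec.span {u} = vec.span {r b}" using Q by (auto simp: graph r_def)
  then obtain c where c: "u = c *s r b" using span_eq_iff[OF \<open>u \<noteq> 0\<close>] by blast
  have "c = 1" using arg_cong[OF c, of "\<lambda>x. h x p"] by simp
  moreover have "c * b = 0" "c * f b = 0" "c * g b = 0"
    using arg_cong[OF c, of "\<lambda>x. h x m"] arg_cong[OF c, of "\<lambda>x. h x n"]
      arg_cong[OF c, of "\<lambda>x. h x u"] by simp_all
  ultimately have r0: "f 0 = 0" "g 0 = 0" by auto
  hence r0': "r 0 = u" by (simp add: r_def pt_def)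
  have aff: "f (b + k * s) = f b + k * (f (b + s) - f b)" if "cj k = k" for b k s
    using baer_condition_imp_affine[OF cop _ that] by (cases "s = 0") auto
  have hom: "f (k * x) = k * f x" if "cj k = k" for k x
    using aff[OF that, of 0 x] r0 by simp
  have "f (x + y) = f x + f y" for x y
  proof -
    have half: "cj (1/2) = 1/2" by simp
    \<comment> \<open>Additivity is affinity at the midpoint of 2x and 2y.\<close>
    have eq: "2 * a + 1/2 * (2 * b - 2 * a) = a + b" "2 * a + (2 * b - 2 * a) = 2 * b" for a b :: 'a
      by (simp_all add: field_simps)
    have f2: "f (2 * z) = 2 * f z" for z by (rule hom) simp
    from aff[OF half, of "2 * x" "2 * y - 2 * x"] show ?thesis unfolding eq f2 .
  qed
  then obtain A B where f: "\<And>b. f b = frob_linear A B b"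
    using additive_homogeneous_eq_frob_linear[OF _ hom] by blast
  have "cj (g b) = g b" for b
  proof (cases "b = 0")
    case False
    hence "vec.span {r b} \<noteq> vec.span {u}" using span_r_inject[of b 0] r0' by simp
    from perspective_imp_fixed[OF persp[OF r_in span_r_neq_p this] False] show ?thesis .
  qed (simp add: r0)
  note g_F = this
  have g: "g b = frob_form A B b" for b
    using r_isotropic[of b] unfolding herm_r_r g_F by (simp add: frob_form_def f field_simps)
  have hr: "h (r b) (r b') = frob_pairing A B b b'" for b b'
    unfolding herm_r_r g_F by (simp add: frob_pairing_def f g)
  have aniso: "frob_form A B b \<noteq> 0" if "b \<noteq> 0" for b
  proof
    assume "frob_form A B b = 0"
    thus False using trace_neq_0[OF that] by (simp add: r0' g herm_sym[of u "r b"])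
  qed
  have skew: "A + cj A = 0"
    using skew_if_special[OF aniso] triple_neq_0 unfolding hr by blast
  have "cj A = - A" using skew by (simp add: add_eq_0_iff)
  hence frob_form: "frob_form A B b = (cj B * b\<^sup>2 + B * (cj b)\<^sup>2) / 2" for b
    by (simp add: frob_form_def frob_linear_def algebra_simps power2_eq_square)
  have "cj B * b\<^sup>2 + B * (cj b)\<^sup>2 \<noteq> 0" if "b \<noteq> 0" for b
    using aniso[OF that] unfolding frob_form by simp
  from minus_norm_is_square[OF this] obtain \<eta>
    where "\<eta> \<noteq> 0" "cj \<eta> = \<eta>" "\<eta>\<^sup>2 = - (B * cj B)" by blast
  from normal_form_equivalent[OF skew this] show ?thesis unfolding graph f g .
qed

end

theorem corollary3p15:
  fixes q :: nat
    and S :: "('a::{field,finite}) subsp set"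
    and P Q l :: "'a subsp"
  assumes "primepow q" and "odd q" and "CARD('a) = q\<^sup>2"
    and "special_set q S"
    and "P \<in> S" and "totally_isotropic_line q l" and "P \<subseteq> l"
    and "\<And>b. baer_subline q l b \<Longrightarrow> P \<in> b \<Longrightarrow>
           coplanar_points {R\<in>S. \<exists>X\<in>b. H_collinear q X R}"
    and "Q \<in> S" and "Q \<noteq> P"
    and "\<And>R. R \<in> S \<Longrightarrow> R \<noteq> P \<Longrightarrow> R \<noteq> Q \<Longrightarrow> in_perspective q P Q R"
  shows "\<exists>\<phi>\<in>PGammaU q. \<phi> ` S = hermitian_veronesean q"
proof -
  interpret hermitian_field q "TYPE('a)"
    by unfold_locales (rule assms(1-3))+
  note S = assms(4)
  obtain p where p: "p \<noteq> 0" "h p p = 0" "P = vec.span {p}" using special_cases[OF S assms(5)] .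
  obtain v where v: "v \<noteq> 0" "h v v = 0" "Q = vec.span {v}" using special_cases[OF S assms(9)] .
  have vp: "h v p \<noteq> 0" using special_noncollinear[OF S] assms(5,9,10) p(3) v(3) by blast
  define u where "u = (1 / h v p) *s v"
  have u: "h u u = 0" "h u p = 1" using v vp by (simp_all add: u_def)
  have "u \<noteq> 0" using v(1) vp by (simp add: u_def)
  hence Q: "Q = vec.span {u}" unfolding v(3) using span_eq_iff[of u v] u_def by metis
  have l: "vec.subspace l" "vec.dim l = 2" "\<And>x. x \<in> l \<Longrightarrow> h x x = 0"
  proof -
    show l: "vec.subspace l" "vec.dim l = 2"
      using assms(6) by (simp_all add: totally_isotropic_line_def pg_line_def)
    fix x assume x: "x \<in> l"
    show "h x x = 0"
    proof (cases "x = 0")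
      case False
      have "vec.span {x} \<subseteq> l" using x l(1) by (simp add: vec.span_minimal)
      moreover have "pg_point (vec.span {x})" using False pg_point_iff by blast
      ultimately have "vec.span {x} \<in> hermitian_surface q"
        using assms(6) by (simp add: totally_isotropic_line_def)
      thus ?thesis by (simp add: span_in_surface_iff)
    qed simp
  qed
  have pl: "p \<in> l" using assms(7) p(3) vec.span_base by blast
  have "\<not> l \<subseteq> vec.span {p}" using vec.dim_le_card[of l "{p}"] l(2) by auto
  then obtain b where b: "b \<in> l" "b \<notin> vec.span {p}" by blast
  have bb: "h b b = 0" using l(3) b(1) .
  have bp: "h b p = 0"
  proof (rule ccontr)
    assume "h b p \<noteq> 0"
    \<comment> \<open>This point of the line would have length 2 h(b,p) cj(h(b,p)).\<close>
    have "b + h b p *s p \<in> l" using b(1) pl l(1) by (simp add: vec.subspace_add vec.subspace_scale)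
    from l(3)[OF this] have "2 * (h b p * cj (h b p)) = 0"
      using bb p(2) herm_sym[of p b] by (simp add: algebra_simps)
    thus False using \<open>h b p \<noteq> 0\<close> by simp
  qed
  define m where "m = b - h b u *s p"
  from frame_exists[OF p(2) u bb bp b(2)] obtain n where "hermitian_frame q p u m n"
    by (auto simp: m_def)
  then interpret hermitian_frame q "TYPE('a)" p u m n .
  have ml: "m \<in> l" using b(1) pl l(1) by (simp add: m_def vec.subspace_diff vec.subspace_scale)
  have "m \<notin> vec.span {p}"
  proof
    assume "m \<in> vec.span {p}"
    then obtain c where "m = c *s p" using span_singleton_iff by blast
    from arg_cong[OF this, of "\<lambda>x. h x n"] show False by simp
  qed
  hence "vec.independent {m, p}" "m \<noteq> p"
    using p(1) vec.independent_insert[of m "{p}"] by (auto intro: vec.span_base)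
  hence dim: "vec.dim (vec.span {p, m}) = 2"
    using vec.dim_span_eq_card_independent[of "{m, p}"] by (simp add: insert_commute)
  have line: "vec.span {p, m} = l"
  proof (rule vec.subspace_dim_equal)
    show "vec.span {p, m} \<subseteq> l" using pl ml l(1) by (intro vec.span_minimal) auto
  qed (use dim l in auto)
  have "vec.span {p} \<in> S" using assms(5) p(3) by simp
  from special_graph_exists[OF S this] obtain f g where "special_graph q p u m n S f g" by blast
  then interpret special_graph q "TYPE('a)" p u m n S f g .
  show ?thesis
  proof (rule special_graph_equivalent)
    show "vec.span {u} \<in> S" using assms(9) Q by simp
  next
    fix T assume "baer_subline q (vec.span {p, m}) T" "vec.span {p} \<in> T"
    thus "coplanar_points {R\<in>S. \<exists>X\<in>T. H_collinear q X R}"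
      using assms(8) unfolding line p(3) by blast
  next
    fix R assume "R \<in> S" "R \<noteq> vec.span {p}" "R \<noteq> vec.span {u}"
    thus "in_perspective q (vec.span {p}) (vec.span {u}) R"
      using assms(11) unfolding p(3) Q by blast
  qed
qed

end
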